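(* Let the moment assumption of the context hold for every dictionary considered, and let $J(s)=Y^{\top}F^{-1}Y$ with $F=C_0+C_1$. (a) (Monotonicity.) If the dictionaries are nested, $\mathrm{span}\{1,\varphi_1,\dots,\varphi_s\}\subseteq\mathrm{span}\{1,\varphi_1,\dots,\varphi_{s+1}\}$, then $J(s+1)\ge J(s)$. (b) (Ceiling.) For every dictionary $$J(s)=\frac{2\,\|\Pi_s h^{*}\|_m^2}{1-\|\Pi_s h^{*}\|_m^2}\le\frac{2\Delta}{2-\Delta},$$ the right-hand side being read as $+\infty$ when $\Delta=2$, with equality if and only if $h^{*}\in\mathrm{span}\{1,\varphi_1,\dots,\varphi_s\}$ (as elements of $L^2(m)$). In particular, when $f_0\neq f_1$, the single-feature dictionary $\varphi_1=h^*$ satisfies the moment assumption and attains the ceiling; when $f_0=f_1$, $h^*=0$ does not give a dictionary satisfying the moment assumption, and every dictionary satisfying it attains the ceiling $0$. If $\Delta<2$ and the union of the nested spans $\mathrm{span}\{1,\varphi_1,\dots,\varphi_s\}$, $s\ge1$, is dense in $L^2(m)$, then, as $s\to\infty$, $J(s)\uparrow 2\Delta/(2-\Delta)$ and $\Lambda^{(s)}\to 2h^{*}/(2-\Delta)$ in $L^2(m)$. (c) (The ceiling is not the symmetrised divergence.) Neither $2\Delta/(2-\Delta)\le D_{\mathrm{KL}}(f_1\|f_0)+D_{\mathrm{KL}}(f_0\|f_1)$ nor the reverse inequality holds in general. For $f_0=$ Bernoulli$(0.01)$ and $f_1=$ Bernoulli$(0.99)$ the ceiling is $2\Delta/(2-\Delta)=0.98^2/0.0198\approx48.5$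 and the symmetrised divergence is $1.96\ln99\approx9.01$; for $f_0=$ Bernoulli$(0.2)$ and $f_1=$ Bernoulli$(0.8)$ the ceiling is $0.36/0.32=1.125$ and the symmetrised divergence is $1.2\ln4\approx1.664$.
   Context: $f_0$ and $f_1$ are probability densities of one real observation $x$ (with respect to Lebesgue measure; for the Bernoulli pairs, with respect to counting measure on $\{0,1\}$, integrals being sums). $\mathbb E_j,\mathrm{Cov}_j$ ($j=0,1$) refer to $x$ with density $f_j$. A dictionary of order $s$ is a vector $\varphi=(\varphi_1,\dots,\varphi_s)^{\top}$ of real functions of $x$. Notation: $u_j=\mathbb E_j\varphi$, $C_j=\mathrm{Cov}_j\varphi$, $F=C_0+C_1$, $Y=u_1-u_0$, $K=F^{-1}Y$, $J(s)=Y^{\top}F^{-1}Y$, $\Lambda^{(s)}(x)=K^{\top}(\varphi(x)-\tfrac12(u_0+u_1))$. Moment assumption: every $\varphi_i$ has a finite second moment under $f_0$ and under $f_1$; $C_0$ is positive definite; $f_1$ vanishes wherever $f_0$ does. $m=\tfrac12(f_0+f_1)$; $L^2(m)$ is the space of functions with finite second moment under $m$, with norm $\|\cdot\|_m$; $h^*=(f_1-f_0)/(f_1+f_0)$; $\Pi_s$ is the orthogonal projection in $L^2(m)$ onto $\mathrm{span}\{1,\varphi_1,\dots,\varphi_s\}$. The triangular discrimination is $$\Delta=\int\frac{(f_1-f_0)^2}{f_1+f_0}\,dx\in[0,2].$$ $D_{\mathrm{KL}}(f\|g)=\int f\ln(f/g)$ is the Kullback–Leibler divergence. *)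

theory Defs
  imports "HOL-Probability.Probability" "Jordan_Normal_Form.Gauss_Jordan_Elimination"
begin

text \<open>Throughout, \<open>\<mu>\<close> is the base measure of the densities \<open>f0\<close>, \<open>f1\<close>: Lebesgue measure, or counting
  measure on \<open>{0, 1}\<close> for Bernoulli pairs. A dictionary of order \<open>s\<close> is a family
  \<open>\<phi> :: nat \<Rightarrow> real \<Rightarrow> real\<close> of which only \<open>\<phi> 0, \<dots>, \<phi> (s - 1)\<close> matter (indices start at 0, as in the
  matrix library).\<close>

definition prob_density :: "real measure \<Rightarrow> (real \<Rightarrow> real) \<Rightarrow> bool" where
  "prob_density \<mu> f \<longleftrightarrow>
     f \<in> borel_measurable \<mu> \<and> (\<forall>x\<in>space \<mu>. 0 \<le> f x) \<and> prob_space (density \<mu> f)"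

definition density_pair :: "real measure \<Rightarrow> (real \<Rightarrow> real) \<Rightarrow> (real \<Rightarrow> real) \<Rightarrow> bool" where
  "density_pair \<mu> f0 f1 \<longleftrightarrow>
     (\<mu> = lborel \<or> \<mu> = count_space {0, 1}) \<and> prob_density \<mu> f0 \<and> prob_density \<mu> f1"

text \<open>Densities are determined only up to \<open>\<mu>\<close>-null sets, so \<open>f1\<close> is required to vanish where \<open>f0\<close>
  does only almost everywhere.\<close>

definition vanishes_with :: "real measure \<Rightarrow> (real \<Rightarrow> real) \<Rightarrow> (real \<Rightarrow> real) \<Rightarrow> bool" where
  "vanishes_with \<mu> f0 f1 \<longleftrightarrow> (AE x in \<mu>. f0 x = 0 \<longrightarrow> f1 x = 0)"

definition mean_vec :: "real measure \<Rightarrow> nat \<Rightarrow> (nat \<Rightarrow> real \<Rightarrow> real) \<Rightarrow> real Matrix.vec" where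
  "mean_vec P s \<phi> = Matrix.vec s (\<lambda>i. \<integral>x. \<phi> i x \<partial>P)"

definition cov_mat :: "real measure \<Rightarrow> nat \<Rightarrow> (nat \<Rightarrow> real \<Rightarrow> real) \<Rightarrow> real Matrix.mat" where
  "cov_mat P s \<phi> = Matrix.mat s s
     (\<lambda>(i, j). \<integral>x. (\<phi> i x - (\<integral>y. \<phi> i y \<partial>P)) * (\<phi> j x - (\<integral>y. \<phi> j y \<partial>P)) \<partial>P)"

definition pos_def :: "nat \<Rightarrow> real Matrix.mat \<Rightarrow> bool" where
  "pos_def s A \<longleftrightarrow> A \<in> carrier_mat s s \<and> transpose_mat A = A \<and>
     (\<forall>v\<in>carrier_vec s. v \<noteq> 0\<^sub>v s \<longrightarrow> 0 < scalar_prod v (A *\<^sub>v v))"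

definition moment_assumption ::
  "real measure \<Rightarrow> (real \<Rightarrow> real) \<Rightarrow> (real \<Rightarrow> real) \<Rightarrow> nat \<Rightarrow> (nat \<Rightarrow> real \<Rightarrow> real) \<Rightarrow> bool" where
  "moment_assumption \<mu> f0 f1 s \<phi> \<longleftrightarrow>
     (\<forall>i<s. \<phi> i \<in> borel_measurable \<mu> \<and>
        integrable (density \<mu> f0) (\<lambda>x. (\<phi> i x)\<^sup>2) \<and> integrable (density \<mu> f1) (\<lambda>x. (\<phi> i x)\<^sup>2)) \<and>
     pos_def s (cov_mat (density \<mu> f0) s \<phi>) \<and>
     vanishes_with \<mu> f0 f1"

definition F_mat ::
  "real measure \<Rightarrow> (real \<Rightarrow> real) \<Rightarrow> (real \<Rightarrow> real) \<Rightarrow> nat \<Rightarrow> (nat \<Rightarrow> real \<Rightarrow> real) \<Rightarrow> real Matrix.mat" where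
  "F_mat \<mu> f0 f1 s \<phi> = cov_mat (density \<mu> f0) s \<phi> + cov_mat (density \<mu> f1) s \<phi>"

definition Y_vec ::
  "real measure \<Rightarrow> (real \<Rightarrow> real) \<Rightarrow> (real \<Rightarrow> real) \<Rightarrow> nat \<Rightarrow> (nat \<Rightarrow> real \<Rightarrow> real) \<Rightarrow> real Matrix.vec" where
  "Y_vec \<mu> f0 f1 s \<phi> = mean_vec (density \<mu> f1) s \<phi> - mean_vec (density \<mu> f0) s \<phi>"

text \<open>\<open>mat_inverse\<close> returns \<open>None\<close> on singular matrices; under the moment assumption \<open>F\<close> is positive
  definite, so \<open>the\<close> is never applied to \<open>None\<close> there.\<close>

definition K_vec ::
  "real measure \<Rightarrow> (real \<Rightarrow> real) \<Rightarrow> (real \<Rightarrow> real) \<Rightarrow> nat \<Rightarrow> (nat \<Rightarrow> real \<Rightarrow> real) \<Rightarrow> real Matrix.vec" where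
  "K_vec \<mu> f0 f1 s \<phi> = the (mat_inverse (F_mat \<mu> f0 f1 s \<phi>)) *\<^sub>v Y_vec \<mu> f0 f1 s \<phi>"

definition J_crit ::
  "real measure \<Rightarrow> (real \<Rightarrow> real) \<Rightarrow> (real \<Rightarrow> real) \<Rightarrow> nat \<Rightarrow> (nat \<Rightarrow> real \<Rightarrow> real) \<Rightarrow> real" where
  "J_crit \<mu> f0 f1 s \<phi> = scalar_prod (Y_vec \<mu> f0 f1 s \<phi>)
     (the (mat_inverse (F_mat \<mu> f0 f1 s \<phi>)) *\<^sub>v Y_vec \<mu> f0 f1 s \<phi>)"

definition Lambda_fun ::
  "real measure \<Rightarrow> (real \<Rightarrow> real) \<Rightarrow> (real \<Rightarrow> real) \<Rightarrow> nat \<Rightarrow> (nat \<Rightarrow> real \<Rightarrow> real) \<Rightarrow> real \<Rightarrow> real" where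
  "Lambda_fun \<mu> f0 f1 s \<phi> x = scalar_prod (K_vec \<mu> f0 f1 s \<phi>)
     (Matrix.vec s (\<lambda>i. \<phi> i x) -
      (1/2) \<cdot>\<^sub>v (mean_vec (density \<mu> f0) s \<phi> + mean_vec (density \<mu> f1) s \<phi>))"

definition mixture :: "real measure \<Rightarrow> (real \<Rightarrow> real) \<Rightarrow> (real \<Rightarrow> real) \<Rightarrow> real measure" where
  "mixture \<mu> f0 f1 = density \<mu> (\<lambda>x. ennreal ((f0 x + f1 x) / 2))"

text \<open>Elements of \<open>L\<^sup>2(m)\<close> are handled through representatives: \<open>L2 m\<close> is the set of functions, and
  equality of classes is equality \<open>m\<close>-almost everywhere.\<close>

definition L2 :: "real measure \<Rightarrow> (real \<Rightarrow> real) set" where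
  "L2 m = {g \<in> borel_measurable m. integrable m (\<lambda>x. (g x)\<^sup>2)}"

definition L2_inner :: "real measure \<Rightarrow> (real \<Rightarrow> real) \<Rightarrow> (real \<Rightarrow> real) \<Rightarrow> real" where
  "L2_inner m g h = (\<integral>x. g x * h x \<partial>m)"

definition L2_norm :: "real measure \<Rightarrow> (real \<Rightarrow> real) \<Rightarrow> real" where
  "L2_norm m g = sqrt (L2_inner m g g)"

definition L2_tendsto :: "real measure \<Rightarrow> (nat \<Rightarrow> real \<Rightarrow> real) \<Rightarrow> (real \<Rightarrow> real) \<Rightarrow> bool" where
  "L2_tendsto m g h \<longleftrightarrow> h \<in> L2 m \<and> (\<forall>\<^sub>F n in sequentially. g n \<in> L2 m) \<and>
     (\<lambda>n. L2_norm m (\<lambda>x. g n x - h x)) \<longlonglongrightarrow> 0"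

text \<open>The span of \<open>1, \<phi> 0, \<dots>, \<phi> (s - 1)\<close> as a subspace of \<open>L\<^sup>2(m)\<close>, that is, closed under changes on
  \<open>m\<close>-null sets.\<close>

definition dict_span :: "real measure \<Rightarrow> nat \<Rightarrow> (nat \<Rightarrow> real \<Rightarrow> real) \<Rightarrow> (real \<Rightarrow> real) set" where
  "dict_span m s \<phi> =
     {g \<in> L2 m. \<exists>c a. AE x in m. g x = c + (\<Sum>i<s. a i * \<phi> i x)}"

text \<open>A representative of the orthogonal projection onto a subspace \<open>V\<close>; it is unique up to \<open>m\<close>-null
  sets, and exists whenever \<open>V\<close> is finite-dimensional.\<close>

definition L2_proj :: "real measure \<Rightarrow> (real \<Rightarrow> real) set \<Rightarrow> (real \<Rightarrow> real) \<Rightarrow> real \<Rightarrow> real" where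
  "L2_proj m V g = (SOME p. p \<in> V \<and> (\<forall>q\<in>V. L2_inner m (\<lambda>x. g x - p x) q = 0))"

text \<open>By \<open>0 / 0 = 0\<close>, \<open>h_star\<close> is 0 where both densities vanish, which is an \<open>m\<close>-null set.\<close>

definition h_star :: "(real \<Rightarrow> real) \<Rightarrow> (real \<Rightarrow> real) \<Rightarrow> real \<Rightarrow> real" where
  "h_star f0 f1 x = (f1 x - f0 x) / (f1 x + f0 x)"

definition triangular :: "real measure \<Rightarrow> (real \<Rightarrow> real) \<Rightarrow> (real \<Rightarrow> real) \<Rightarrow> real" where
  "triangular \<mu> f0 f1 = (\<integral>x. (f1 x - f0 x)\<^sup>2 / (f1 x + f0 x) \<partial>\<mu>)"

definition ceiling_J :: "real measure \<Rightarrow> (real \<Rightarrow> real) \<Rightarrow> (real \<Rightarrow> real) \<Rightarrow> ereal" where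
  "ceiling_J \<mu> f0 f1 =
     (if triangular \<mu> f0 f1 = 2 then \<infinity>
      else ereal (2 * triangular \<mu> f0 f1 / (2 - triangular \<mu> f0 f1)))"

text \<open>The integral of \<open>f ln (f / g)\<close> with its value \<open>\<infinity>\<close> made explicit: its negative part is always
  integrable, so it is infinite exactly if \<open>f > 0 = g\<close> on a non-null set or the integrand is not
  integrable. (The library's \<open>KL_divergence\<close> is real-valued.)\<close>

definition KL_div :: "real measure \<Rightarrow> (real \<Rightarrow> real) \<Rightarrow> (real \<Rightarrow> real) \<Rightarrow> ereal" where
  "KL_div \<mu> f g =
     (if (AE x in \<mu>. g x = 0 \<longrightarrow> f x = 0) \<and> integrable \<mu> (\<lambda>x. f x * ln (f x / g x))
      then ereal (\<integral>x. f x * ln (f x / g x) \<partial>\<mu>) else \<infinity>)"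

definition sym_div :: "real measure \<Rightarrow> (real \<Rightarrow> real) \<Rightarrow> (real \<Rightarrow> real) \<Rightarrow> ereal" where
  "sym_div \<mu> f0 f1 = KL_div \<mu> f1 f0 + KL_div \<mu> f0 f1"

definition bernoulli_density :: "real \<Rightarrow> real \<Rightarrow> real" where
  "bernoulli_density p = pmf (map_pmf of_bool (bernoulli_pmf p))"

end

theory Submission
  imports Defs "Jordan_Normal_Form.Determinant"
begin

unbundle no vec_syntax

text \<open>Every \<open>g\<close> in \<open>L\<^sup>2(m)\<close> satisfies \<open>E\<^sub>1 g - E\<^sub>0 g = 2 \<langle>h\<^sup>*, g\<rangle>\<close>, and
  \<open>Cov\<^sub>0 + Cov\<^sub>1\<close> of two functions \<open>g\<close>, \<open>l\<close> with \<open>E\<^sub>m l = 0\<close> is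
  \<open>2 \<langle>g, l\<rangle> - 2 \<langle>h\<^sup>*, g\<rangle> \<langle>h\<^sup>*, l\<rangle>\<close>. Hence \<open>F K = Y\<close> says exactly that
  \<open>\<Lambda> = (1 + J/2) \<Pi> h\<^sup>*\<close>, while \<open>J = 2 \<langle>h\<^sup>*, \<Lambda>\<rangle>\<close>; eliminating \<open>\<Lambda>\<close> gives
  \<open>J = 2N / (1 - N)\<close> with \<open>N = \<parallel>\<Pi> h\<^sup>*\<parallel>\<^sup>2\<close>. As \<open>\<parallel>h\<^sup>*\<parallel>\<^sup>2 = \<Delta>/2\<close>, monotonicity, ceiling and limit
  are statements about best approximation of \<open>h\<^sup>*\<close> from subspaces.\<close>

section \<open>Inverting a positive definite matrix\<close>

text \<open>A kernel vector v \<noteq> 0 would make the quadratic form vanish at v. So the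
  determinant is nonzero and \<open>mat_inverse\<close> returns \<open>Some\<close>.\<close>

lemma pos_def_mat_inverse:
  assumes A: "A \<in> carrier_mat s s"
    and pos: "\<And>v. v \<in> carrier_vec s \<Longrightarrow> v \<noteq> 0\<^sub>v s \<Longrightarrow> 0 < scalar_prod v (A *\<^sub>v v)"
    and y: "(y :: real Matrix.vec) \<in> carrier_vec s"
  shows "the (mat_inverse A) *\<^sub>v y \<in> carrier_vec s" "A *\<^sub>v (the (mat_inverse A) *\<^sub>v y) = y"
proof -
  have "Determinant.det A \<noteq> 0"
  proof
    assume "Determinant.det A = 0"
    then obtain v where v: "v \<in> carrier_vec s" "v \<noteq> 0\<^sub>v s" "A *\<^sub>v v = 0\<^sub>v s"
      using det_0_iff_vec_prod_zero_field[OF A] by blast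
    with pos[of v] show False by simp
  qed
  then obtain B where "mat_inverse A = Some B"
    using mat_inverse(1)[OF A, of "()"] det_non_zero_imp_unit[OF A, of "()"] by (cases "mat_inverse A") auto
  with mat_inverse(2)[OF A this] A y
  show "the (mat_inverse A) *\<^sub>v y \<in> carrier_vec s" "A *\<^sub>v (the (mat_inverse A) *\<^sub>v y) = y"
    by (auto simp flip: assoc_mult_mat_vec)
qed

section \<open>Square-integrable functions and their inner product\<close>

lemma L2_D [dest]:
  assumes "g \<in> L2 M" shows "g \<in> borel_measurable M" "integrable M (\<lambda>x. (g x)\<^sup>2)"
  using assms by (auto simp: L2_def)

text \<open>The product is dominated by \<open>(g x)\<^sup>2 + (h x)\<^sup>2\<close>. Inner products
  of \<open>L2\<close> functions are therefore genuine integrals, never the default value 0 of a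
  non-integrable function.\<close>

lemma L2_mult_integrable:
  assumes "g \<in> L2 M" "h \<in> L2 M"
  shows "integrable M (\<lambda>x. g x * h x)"
proof (rule Bochner_Integration.integrable_bound)
  show "integrable M (\<lambda>x. (g x)\<^sup>2 + (h x)\<^sup>2)" using assms by auto
  have "\<bar>a * b\<bar> \<le> a\<^sup>2 + b\<^sup>2" for a b :: real
    using sum_squares_bound[of "\<bar>a\<bar>" "\<bar>b\<bar>"] abs_ge_zero[of "a * b"]
    unfolding abs_mult power2_abs by linarith
  then show "AE x in M. norm (g x * h x) \<le> norm ((g x)\<^sup>2 + (h x)\<^sup>2)" by simp
  show "(\<lambda>x. g x * h x) \<in> borel_measurable M" using assms[THEN L2_D(1)] by measurable
qed

lemma L2_scale: "g \<in> L2 M \<Longrightarrow> (\<lambda>x. a * g x) \<in> L2 M"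
  by (auto simp: L2_def power_mult_distrib)

lemma L2_add:
  assumes "g \<in> L2 M" "h \<in> L2 M" shows "(\<lambda>x. g x + h x) \<in> L2 M"
  using assms L2_mult_integrable[OF assms] by (auto simp: L2_def power2_sum mult.assoc)

lemma L2_diff:
  assumes "g \<in> L2 M" "h \<in> L2 M" shows "(\<lambda>x. g x - h x) \<in> L2 M"
  using L2_add[OF assms(1) L2_scale[OF assms(2), of "-1"]] by simp

lemma L2_const: "finite_measure M \<Longrightarrow> (\<lambda>_. c) \<in> L2 M"
  by (simp add: L2_def finite_measure.integrable_const)

lemma L2_sum:
  assumes "finite_measure M" "\<And>i. i \<in> I \<Longrightarrow> g i \<in> L2 M"
  shows "(\<lambda>x. \<Sum>i\<in>I. g i x) \<in> L2 M"
  using assms(2)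
  by (induction I rule: infinite_finite_induct) (auto intro: L2_const[OF assms(1)] L2_add)

lemma L2_integrable:
  assumes "finite_measure M" "g \<in> L2 M" shows "integrable M g"
  using L2_mult_integrable[OF assms(2) L2_const[OF assms(1), of 1]] by simp

lemma L2_cong_AE:
  assumes "g \<in> L2 M" "h \<in> borel_measurable M" "AE x in M. h x = g x"
  shows "h \<in> L2 M"
proof -
  have "integrable M (\<lambda>x. (h x)\<^sup>2) \<longleftrightarrow> integrable M (\<lambda>x. (g x)\<^sup>2)"
    using assms(1)[THEN L2_D(1)] assms(2,3) by (intro integrable_cong_AE) auto
  then show ?thesis using assms by (auto simp: L2_def)
qed

lemma L2_inner_commute: "L2_inner M g h = L2_inner M h g"
  by (simp add: L2_inner_def mult.commute)

lemma L2_inner_scale: "L2_inner M (\<lambda>x. a * g x) h = a * L2_inner M g h"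
  by (simp add: L2_inner_def mult.assoc)

lemma L2_inner_diff:
  assumes "g \<in> L2 M" "g' \<in> L2 M" "h \<in> L2 M"
  shows "L2_inner M (\<lambda>x. g x - g' x) h = L2_inner M g h - L2_inner M g' h"
  using assms by (simp add: L2_inner_def left_diff_distrib L2_mult_integrable)

lemma L2_inner_cong_AE:
  assumes "g \<in> L2 M" "g' \<in> L2 M" "h \<in> L2 M" "AE x in M. g x = g' x"
  shows "L2_inner M g h = L2_inner M g' h"
  unfolding L2_inner_def
  using assms(1-3)[THEN L2_D(1)] assms(4) by (intro integral_cong_AE) auto

lemma L2_inner_nonneg: "0 \<le> L2_inner M g g"
  by (simp add: L2_inner_def)

lemma L2_inner_diff_diff:
  assumes "g \<in> L2 M" "h \<in> L2 M"
  shows "L2_inner M (\<lambda>x. g x - h x) (\<lambda>x. g x - h x)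
    = L2_inner M g g - 2 * L2_inner M g h + L2_inner M h h"
proof -
  let ?d = "\<lambda>x. g x - h x"
  \<comment> \<open>Linearity is available in the first argument, so symmetry moves the difference
    there.\<close>
  have "L2_inner M ?d ?d = L2_inner M ?d g - L2_inner M ?d h"
    using L2_inner_diff[OF assms L2_diff[OF assms]]
    by (simp only: L2_inner_commute[of M g ?d] L2_inner_commute[of M h ?d])
  then show ?thesis
    using assms by (simp add: L2_inner_diff L2_inner_commute[of M h g])
qed

lemma L2_inner_eq_0_iff:
  assumes "g \<in> L2 M" shows "L2_inner M g g = 0 \<longleftrightarrow> (AE x in M. g x = 0)"
proof -
  have "integrable M (\<lambda>x. g x * g x)" using assms by (rule L2_mult_integrable) fact
  then show ?thesis by (simp add: L2_inner_def integral_nonneg_eq_0_iff_AE)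
qed

lemma L2_norm_sq: "(L2_norm M g)\<^sup>2 = L2_inner M g g"
  by (simp add: L2_norm_def L2_inner_nonneg)

section \<open>Means and covariances of affine combinations of features\<close>

lemma expectation_affine:
  fixes \<phi> :: "nat \<Rightarrow> real \<Rightarrow> real" and c :: real
  assumes P: "prob_space P" and phi: "\<And>i. i < s \<Longrightarrow> \<phi> i \<in> L2 P"
  shows "(\<integral>x. c + (\<Sum>i<s. a i * \<phi> i x) \<partial>P) = c + (\<Sum>i<s. a i * (\<integral>x. \<phi> i x \<partial>P))"
proof -
  interpret P: prob_space P by fact
  have int: "integrable P (\<phi> i)" if "i < s" for i
    using L2_integrable[OF P.finite_measure_axioms phi[OF that]] .
  have "(\<integral>x. c + (\<Sum>i<s. a i * \<phi> i x) \<partial>P)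
    = (\<integral>x. c \<partial>P) + (\<integral>x. (\<Sum>i<s. a i * \<phi> i x) \<partial>P)"
    by (rule Bochner_Integration.integral_add)
      (auto intro!: Bochner_Integration.integrable_sum integrable_mult_right int)
  also have "(\<integral>x. (\<Sum>i<s. a i * \<phi> i x) \<partial>P) = (\<Sum>i<s. \<integral>x. a i * \<phi> i x \<partial>P)"
    by (rule Bochner_Integration.integral_sum) (auto intro!: integrable_mult_right int)
  finally show ?thesis by (simp add: P.prob_space)
qed

text \<open>A covariance ignores additive constants, so the intercepts \<open>c\<close>, \<open>d\<close> are arbitrary.\<close>

lemma cov_mat_bilinear:
  fixes v w :: "real Matrix.vec" and c d :: real
  assumes P: "prob_space P" and phi: "\<And>i. i < s \<Longrightarrow> \<phi> i \<in> L2 P"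
    and v: "v \<in> carrier_vec s" and w: "w \<in> carrier_vec s"
  defines "g \<equiv> \<lambda>x. c + (\<Sum>i<s. v $ i * \<phi> i x)" and "l \<equiv> \<lambda>x. d + (\<Sum>i<s. w $ i * \<phi> i x)"
  shows "scalar_prod v (cov_mat P s \<phi> *\<^sub>v w)
    = (\<integral>x. g x * l x \<partial>P) - (\<integral>x. g x \<partial>P) * (\<integral>x. l x \<partial>P)"
proof -
  interpret P: prob_space P by fact
  note fin = P.finite_measure_axioms
  define u where "u i = (\<integral>x. \<phi> i x \<partial>P)" for i
  define r where "r i x = \<phi> i x - u i" for i x
  have r: "r i \<in> L2 P" if "i < s" for i
    unfolding r_def by (intro L2_diff phi that L2_const fin)
  have aff: "(\<lambda>x. e + (\<Sum>i<s. b $ i * \<phi> i x)) \<in> L2 P"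
    "(\<integral>x. e + (\<Sum>i<s. b $ i * \<phi> i x) \<partial>P) = e + (\<Sum>i<s. b $ i * u i)" for e and b :: "real Matrix.vec"
    unfolding u_def
    by (intro L2_add L2_const L2_sum L2_scale phi fin expectation_affine[OF P]; auto simp: phi)+
  have gL: "g \<in> L2 P" "l \<in> L2 P" unfolding g_def l_def by (rule aff)+
  define eg el where "eg = (\<integral>x. g x \<partial>P)" and "el = (\<integral>x. l x \<partial>P)"
  \<comment> \<open>Centring removes the intercept: what remains is the same combination of the
    centred features \<open>r i\<close>.\<close>
  have gr: "g x - eg = (\<Sum>i<s. v $ i * r i x)" for x
    unfolding eg_def g_def aff r_def by (simp add: right_diff_distrib sum_subtractf)
  have lr: "l x - el = (\<Sum>i<s. w $ i * r i x)" for x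
    unfolding el_def l_def aff r_def by (simp add: right_diff_distrib sum_subtractf)
  have "scalar_prod v (cov_mat P s \<phi> *\<^sub>v w)
    = (\<Sum>i<s. v $ i * (\<Sum>j<s. (\<integral>x. r i x * r j x \<partial>P) * w $ j))"
    using v w by (simp add: scalar_prod_def cov_mat_def r_def u_def lessThan_atLeast0)
  also have "\<dots> = (\<Sum>i<s. \<Sum>j<s. (\<integral>x. (v $ i * r i x) * (w $ j * r j x) \<partial>P))"
    unfolding sum_distrib_left by (simp add: mult_ac)
  also have "\<dots> = (\<integral>x. (\<Sum>i<s. \<Sum>j<s. (v $ i * r i x) * (w $ j * r j x)) \<partial>P)"
    by (subst Bochner_Integration.integral_sum)
      (auto intro!: sum.cong Bochner_Integration.integral_sum[symmetric]
        Bochner_Integration.integrable_sum L2_mult_integrable L2_scale r)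
  also have "\<dots> = (\<integral>x. (g x - eg) * (l x - el) \<partial>P)"
    by (simp add: gr lr sum_product)
  also have "\<dots> = (\<integral>x. g x * l x - (el * g x + (eg * l x - eg * el)) \<partial>P)"
    by (intro Bochner_Integration.integral_cong refl) (simp add: algebra_simps)
  also have "\<dots> = (\<integral>x. g x * l x \<partial>P) - eg * el"
    using L2_mult_integrable[OF gL] L2_integrable[OF fin gL(1)] L2_integrable[OF fin gL(2)]
    by (simp add: eg_def[symmetric] el_def[symmetric] P.prob_space)
  finally show ?thesis by (simp add: eg_def el_def)
qed

section \<open>A pair of densities and its mixture\<close>

text \<open>Leaving the base measure arbitrary treats Lebesgue measure and the Bernoulli pairs by
  one argument.\<close>

locale two_densities =
  fixes \<mu> :: "real measure" and f0 f1 :: "real \<Rightarrow> real"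
  assumes dens0: "prob_density \<mu> f0" and dens1: "prob_density \<mu> f1"
begin

abbreviation "P0 \<equiv> density \<mu> f0"
abbreviation "P1 \<equiv> density \<mu> f1"
abbreviation "m \<equiv> mixture \<mu> f0 f1"
abbreviation "h \<equiv> h_star f0 f1"
abbreviation "\<Delta> \<equiv> triangular \<mu> f0 f1"

lemma f_measurable [measurable]: "f0 \<in> borel_measurable \<mu>" "f1 \<in> borel_measurable \<mu>"
  using dens0 dens1 by (auto simp: prob_density_def)

lemma f_nonneg: "x \<in> space \<mu> \<Longrightarrow> 0 \<le> f0 x" "x \<in> space \<mu> \<Longrightarrow> 0 \<le> f1 x"
  using dens0 dens1 by (auto simp: prob_density_def)

lemma AE_f_nonneg: "AE x in \<mu>. 0 \<le> f0 x" "AE x in \<mu>. 0 \<le> f1 x" "AE x in \<mu>. 0 \<le> (f0 x + f1 x) / 2"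
  by (auto intro!: AE_I2 simp: f_nonneg)

lemma prob_spaces: "prob_space P0" "prob_space P1"
  using dens0 dens1 by (auto simp: prob_density_def)

lemma sets_mixture [measurable_cong]: "sets m = sets \<mu>"
  by (simp add: mixture_def)

lemma h_measurable [measurable]: "h \<in> borel_measurable \<mu>"
  unfolding h_star_def by measurable

text \<open>For nonnegative numbers the difference is at most the sum in absolute value; where both
  densities vanish, \<open>h\<close> is 0 by \<open>0 / 0 = 0\<close>.\<close>

lemma abs_h_le_1: "x \<in> space \<mu> \<Longrightarrow> \<bar>h x\<bar> \<le> 1"
  using f_nonneg[of x] by (cases "f0 x + f1 x = 0") (auto simp: h_star_def abs_divide divide_le_eq)

text \<open>Links the moment assumption, which speaks of the two densities separately, to the
  mixture. Each density is nonnegative and at most \<open>f0 x + f1 x\<close>, so the mixture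
  integrand dominates both up to a factor 2.\<close>

lemma integrable_iff:
  assumes [measurable]: "g \<in> borel_measurable \<mu>"
  shows "integrable P0 g \<longleftrightarrow> integrable \<mu> (\<lambda>x. f0 x * g x)"
    "integrable P1 g \<longleftrightarrow> integrable \<mu> (\<lambda>x. f1 x * g x)"
    "integrable m g \<longleftrightarrow> integrable P0 g \<and> integrable P1 g"
proof -
  have 0: "integrable P0 g \<longleftrightarrow> integrable \<mu> (\<lambda>x. f0 x * g x)"
    "integrable P1 g \<longleftrightarrow> integrable \<mu> (\<lambda>x. f1 x * g x)"
    if [measurable]: "g \<in> borel_measurable \<mu>" for g :: "real \<Rightarrow> real"
    using AE_f_nonneg by (simp_all add: integrable_density)
  have 2: "integrable m g \<longleftrightarrow> integrable \<mu> (\<lambda>x. (f0 x + f1 x) / 2 * g x)"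
    using AE_f_nonneg unfolding mixture_def by (subst integrable_density) auto
  show "integrable P0 g \<longleftrightarrow> integrable \<mu> (\<lambda>x. f0 x * g x)"
    "integrable P1 g \<longleftrightarrow> integrable \<mu> (\<lambda>x. f1 x * g x)"
    by (rule 0[OF assms])+
  show "integrable m g \<longleftrightarrow> integrable P0 g \<and> integrable P1 g"
    unfolding 0[OF assms] 2
  proof safe
    assume i: "integrable \<mu> (\<lambda>x. (f0 x + f1 x) / 2 * g x)"
    from integrable_mult_right[OF this, of 2]
    have i2: "integrable \<mu> (\<lambda>x. (f0 x + f1 x) * g x)" by simp
    show "integrable \<mu> (\<lambda>x. f0 x * g x)"
      by (rule Bochner_Integration.integrable_bound[OF i2])
        (auto intro!: AE_I2 mult_right_mono simp: abs_mult f_nonneg)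
    show "integrable \<mu> (\<lambda>x. f1 x * g x)"
      by (rule Bochner_Integration.integrable_bound[OF i2])
        (auto intro!: AE_I2 mult_right_mono simp: abs_mult f_nonneg)
  next
    assume "integrable \<mu> (\<lambda>x. f0 x * g x)" "integrable \<mu> (\<lambda>x. f1 x * g x)"
    from Bochner_Integration.integrable_add[OF this]
    have "integrable \<mu> (\<lambda>x. (f0 x * g x + f1 x * g x) / 2)" by simp
    then show "integrable \<mu> (\<lambda>x. (f0 x + f1 x) / 2 * g x)" by (simp add: algebra_simps)
  qed
qed

text \<open>The weight of \<open>m\<close> is half the sum of the densities; multiplied by
  \<open>h\<close> it becomes half their difference, which gives the second identity.\<close>

lemma integral_mixture:
  assumes [measurable]: "g \<in> borel_measurable \<mu>" and i: "integrable m g"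
  shows "(\<integral>x. g x \<partial>m) = ((\<integral>x. g x \<partial>P0) + (\<integral>x. g x \<partial>P1)) / 2"
    "(\<integral>x. h x * g x \<partial>m) = ((\<integral>x. g x \<partial>P1) - (\<integral>x. g x \<partial>P0)) / 2"
proof -
  have int: "integrable \<mu> (\<lambda>x. f0 x * g x)" "integrable \<mu> (\<lambda>x. f1 x * g x)"
    using i integrable_iff[of g] by auto
  have P: "(\<integral>x. g x \<partial>P0) = (\<integral>x. f0 x * g x \<partial>\<mu>)" "(\<integral>x. g x \<partial>P1) = (\<integral>x. f1 x * g x \<partial>\<mu>)"
    using AE_f_nonneg by (simp_all add: integral_density)
  have m: "(\<integral>x. k x \<partial>m) = (\<integral>x. (f0 x + f1 x) / 2 * k x \<partial>\<mu>)"
    if [measurable]: "k \<in> borel_measurable \<mu>" for k :: "real \<Rightarrow> real"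
    using AE_f_nonneg unfolding mixture_def by (subst integral_density) auto
  have "(\<integral>x. (f0 x + f1 x) / 2 * g x \<partial>\<mu>) = (\<integral>x. (f0 x * g x + f1 x * g x) / 2 \<partial>\<mu>)"
    by (simp add: algebra_simps)
  then show "(\<integral>x. g x \<partial>m) = ((\<integral>x. g x \<partial>P0) + (\<integral>x. g x \<partial>P1)) / 2"
    using int by (simp add: P m)
  have "(\<integral>x. (f0 x + f1 x) / 2 * (h x * g x) \<partial>\<mu>) = (\<integral>x. (f1 x * g x - f0 x * g x) / 2 \<partial>\<mu>)"
  proof (rule Bochner_Integration.integral_cong[OF refl])
    fix x assume "x \<in> space \<mu>"
    \<comment> \<open>If the sum is 0, both nonnegative summands are 0 and the identity reads 0 =
      0.\<close>
    then have "(f0 x + f1 x) * h x = f1 x - f0 x"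
      using f_nonneg[of x] by (auto simp: h_star_def add.commute)
    then have "(f0 x + f1 x) / 2 * (h x * g x) = (f1 x - f0 x) * g x / 2"
      by (metis (no_types) mult.assoc times_divide_eq_left)
    then show "(f0 x + f1 x) / 2 * (h x * g x) = (f1 x * g x - f0 x * g x) / 2"
      by (simp add: left_diff_distrib)
  qed
  then show "(\<integral>x. h x * g x \<partial>m) = ((\<integral>x. g x \<partial>P1) - (\<integral>x. g x \<partial>P0)) / 2"
    using int by (simp add: P m)
qed

lemma L2_mixture_iff: "g \<in> L2 m \<longleftrightarrow> g \<in> L2 P0 \<and> g \<in> L2 P1"
proof (cases "g \<in> borel_measurable \<mu>")
  case True
  then have "(\<lambda>x. (g x)\<^sup>2) \<in> borel_measurable \<mu>" by simp
  from integrable_iff(3)[OF this] True show ?thesis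
    by (simp add: L2_def mixture_def)
qed (simp add: L2_def mixture_def)

lemma prob_space_mixture: "prob_space m"
proof
  have mass: "(\<integral>\<^sup>+x. ennreal (f x) \<partial>\<mu>) = emeasure (density \<mu> f) (space \<mu>)"
    if [measurable]: "f \<in> borel_measurable \<mu>" for f
    by (subst emeasure_density) (auto intro!: nn_integral_cong)
  have *: "(\<integral>\<^sup>+x. ennreal (f0 x) \<partial>\<mu>) = 1" "(\<integral>\<^sup>+x. ennreal (f1 x) \<partial>\<mu>) = 1"
    using prob_spaces[THEN prob_space.emeasure_space_1] by (simp_all add: mass)
  have "emeasure m (space m) = (\<integral>\<^sup>+x. ennreal ((f0 x + f1 x) / 2) \<partial>\<mu>)"
    unfolding mixture_def by (simp add: mass)
  also have "\<dots> = (\<integral>\<^sup>+x. (ennreal (f0 x) + ennreal (f1 x)) / 2 \<partial>\<mu>)"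
    using f_nonneg by (intro nn_integral_cong)
      (simp flip: ennreal_plus ennreal_numeral add: divide_ennreal)
  also have "\<dots> = 1"
    by (simp add: nn_integral_divide nn_integral_add *)
  finally show "emeasure m (space m) = 1" .
qed

lemma finite_mixture: "finite_measure m"
  using prob_space_mixture by (simp add: prob_space_def)

lemma h_L2: "h \<in> L2 m"
proof -
  interpret finite_measure m by (rule finite_mixture)
  have "integrable m (\<lambda>x. (h x)\<^sup>2)"
    using abs_h_le_1 by (intro integrable_const_bound[where B = 1])
      (auto intro!: AE_I2 simp: mixture_def abs_square_le_1)
  then show ?thesis by (simp add: L2_def)
qed

text \<open>Up to the factor 2, \<open>h\<close> is the Riesz representer of the difference of the
  two means. This turns \<open>Y_vec\<close> into inner products with \<open>h\<close>.\<close>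

lemma inner_h:
  assumes "g \<in> L2 m"
  shows "L2_inner m h g = ((\<integral>x. g x \<partial>P1) - (\<integral>x. g x \<partial>P0)) / 2"
  unfolding L2_inner_def
  using assms L2_integrable[OF finite_mixture assms] by (intro integral_mixture) (auto simp: L2_def mixture_def)

text \<open>Half the sum of the densities cancels one denominator of the square of \<open>h\<close>,
  leaving half the integrand of \<Delta>.\<close>

lemma inner_h_h: "L2_inner m h h = \<Delta> / 2"
proof -
  have "L2_inner m h h = (\<integral>x. (f0 x + f1 x) / 2 * (h x * h x) \<partial>\<mu>)"
    using AE_f_nonneg unfolding mixture_def L2_inner_def by (subst integral_density) auto
  also have "\<dots> = (\<integral>x. (f1 x - f0 x)\<^sup>2 / (f1 x + f0 x) / 2 \<partial>\<mu>)"
    by (intro Bochner_Integration.integral_cong refl)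
      (simp add: h_star_def power2_eq_square add.commute)
  finally show ?thesis unfolding triangular_def integral_divide_zero .
qed

text \<open>A density that is zero almost everywhere defines the null measure, under which even
  \<open>False\<close> holds almost everywhere; a probability space excludes this.\<close>

lemma not_AE_f_eq_0: "\<not> (AE x in \<mu>. f0 x = 0)" "\<not> (AE x in \<mu>. f1 x = 0)"
proof -
  have "\<not> (AE x in density \<mu> f. False)" if "prob_density \<mu> f" for f
    using that prob_space.AE_False unfolding prob_density_def by blast
  moreover have "AE x in density \<mu> f. False" if "prob_density \<mu> f" "AE x in \<mu>. f x = 0" for f
    using that by (subst AE_density) (auto simp: prob_density_def)
  ultimately show "\<not> (AE x in \<mu>. f0 x = 0)" "\<not> (AE x in \<mu>. f1 x = 0)"
    using dens0 dens1 by blast+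
qed

text \<open>The integral of 1 - \<open>h x * h x\<close> under \<open>m\<close> is 1 - \<Delta>/2,
  with nonnegative integrand. If it were 0, no point (up to null sets) would have both densities
  positive; since \<open>f1\<close> vanishes with \<open>f0\<close>, this would force
  \<open>f1\<close> to be zero almost everywhere.\<close>

lemma triangular_less_2:
  assumes "vanishes_with \<mu> f0 f1"
  shows "\<Delta> < 2"
proof -
  interpret M: prob_space m by (rule prob_space_mixture)
  have m: "integrable m (\<lambda>x. h x * h x)" by (rule L2_mult_integrable[OF h_L2 h_L2])
  have nn: "AE x in m. 0 \<le> 1 - h x * h x"
    using abs_h_le_1 by (intro AE_I2) (auto simp: mixture_def abs_square_le_1 simp flip: power2_eq_square)
  have eq: "(\<integral>x. 1 - h x * h x \<partial>m) = 1 - \<Delta> / 2"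
    using m inner_h_h by (simp add: L2_inner_def M.prob_space)
  have "(\<integral>x. 1 - h x * h x \<partial>m) \<noteq> 0"
  proof
    assume "(\<integral>x. 1 - h x * h x \<partial>m) = 0"
    then have "AE x in m. 1 - h x * h x = 0"
      using m nn by (subst (asm) integral_nonneg_eq_0_iff_AE) auto
    then have "AE x in \<mu>. 0 < (f0 x + f1 x) / 2 \<longrightarrow> 1 - h x * h x = 0"
      unfolding mixture_def by (subst (asm) AE_density) auto
    then have "AE x in \<mu>. f1 x = 0"
      using assms[unfolded vanishes_with_def] AE_f_nonneg(1,2)
    proof eventually_elim
      case (elim x)
      show ?case
      proof (rule ccontr)
        assume "f1 x \<noteq> 0"
        with elim have pos: "f0 x > 0" "f1 x > 0" by auto
        with elim(1) have "(f1 x - f0 x) * (f1 x - f0 x) = (f1 x + f0 x) * (f1 x + f0 x)"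
          by (auto simp: h_star_def)
        \<comment> \<open>The two squares differ by 4 \<open>f0 x * f1 x\<close>.\<close>
        then have "f0 x * f1 x = 0" by (simp add: algebra_simps)
        with pos show False by simp
      qed
    qed
    with not_AE_f_eq_0 show False by simp
  qed
  moreover have "0 \<le> (\<integral>x. 1 - h x * h x \<partial>m)" using nn by (rule integral_nonneg_AE)
  ultimately show ?thesis using eq by simp
qed

end

section \<open>Dictionary spans, the matrix F and the normal equation for \<Lambda>\<close>

lemma dict_span_D: "g \<in> dict_span M s \<phi> \<Longrightarrow> g \<in> L2 M"
  by (simp add: dict_span_def)

lemma dict_span_scale:
  assumes "g \<in> dict_span M s \<phi>" shows "(\<lambda>x. k * g x) \<in> dict_span M s \<phi>"
proof -
  obtain c a where "AE x in M. g x = c + (\<Sum>i<s. a i * \<phi> i x)"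
    using assms by (auto simp: dict_span_def)
  then have "AE x in M. k * g x = k * c + (\<Sum>i<s. (k * a i) * \<phi> i x)"
    by eventually_elim (simp add: distrib_left sum_distrib_left mult.assoc)
  then show ?thesis
    using L2_scale[OF dict_span_D[OF assms], of k] unfolding dict_span_def
    by (intro CollectI conjI exI)
qed

text \<open>The quadratic form of a covariance matrix at v is the variance of the combination of
  features with coefficients v.\<close>

lemma cov_mat_nonneg:
  fixes v :: "real Matrix.vec"
  assumes P: "prob_space P" and phi: "\<And>i. i < s \<Longrightarrow> \<phi> i \<in> L2 P" and v: "v \<in> carrier_vec s"
  shows "0 \<le> scalar_prod v (cov_mat P s \<phi> *\<^sub>v v)"
proof -
  interpret P: prob_space P by fact
  note fin = P.finite_measure_axioms
  \<comment> \<open>The summand 0 is the intercept, kept so that \<open>g\<close> has the shape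
    required by \<open>cov_mat_bilinear\<close>.\<close>
  define g where "g x = 0 + (\<Sum>i<s. v $ i * \<phi> i x)" for x
  have g: "g \<in> L2 P"
    unfolding g_def by (intro L2_add L2_const L2_sum L2_scale phi fin) auto
  have "scalar_prod v (cov_mat P s \<phi> *\<^sub>v v) = (\<integral>x. (g x)\<^sup>2 \<partial>P) - (\<integral>x. g x \<partial>P)\<^sup>2"
    using cov_mat_bilinear[OF P phi v v, where c = 0 and d = 0]
    unfolding g_def power2_eq_square .
  also have "\<dots> = P.variance g"
    using L2_integrable[OF fin g] L2_D(2)[OF g] by (simp add: P.variance_eq)
  also have "\<dots> \<ge> 0" by (rule P.variance_positive)
  finally show ?thesis .
qed

context two_densities
begin

abbreviation "J \<equiv> J_crit \<mu> f0 f1"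
abbreviation "\<Lambda> \<equiv> Lambda_fun \<mu> f0 f1"
abbreviation "V \<equiv> dict_span m"

lemma moment_L2:
  assumes "moment_assumption \<mu> f0 f1 s \<phi>" "i < s"
  shows "\<phi> i \<in> L2 P0" "\<phi> i \<in> L2 P1" "\<phi> i \<in> L2 m"
proof -
  show "\<phi> i \<in> L2 P0" "\<phi> i \<in> L2 P1"
    using assms by (auto simp: moment_assumption_def L2_def)
  then show "\<phi> i \<in> L2 m" by (simp add: L2_mixture_iff)
qed

text \<open>The covariance under \<open>f0\<close> is positive definite by assumption and the one
  under \<open>f1\<close> is at least semidefinite.\<close>

lemma F_mat_pos:
  assumes mom: "moment_assumption \<mu> f0 f1 s \<phi>" and v: "v \<in> carrier_vec s" "v \<noteq> 0\<^sub>v s"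
  shows "0 < scalar_prod v (F_mat \<mu> f0 f1 s \<phi> *\<^sub>v v)"
proof -
  have C: "cov_mat P s \<phi> \<in> carrier_mat s s" for P by (simp add: cov_mat_def)
  have "scalar_prod v (F_mat \<mu> f0 f1 s \<phi> *\<^sub>v v)
    = scalar_prod v (cov_mat P0 s \<phi> *\<^sub>v v) + scalar_prod v (cov_mat P1 s \<phi> *\<^sub>v v)"
    unfolding F_mat_def using v(1) mult_mat_vec_carrier[OF C v(1)]
    by (simp add: add_mult_distrib_mat_vec[OF C C v(1)] scalar_prod_add_distrib[of _ s])
  moreover have "0 < scalar_prod v (cov_mat P0 s \<phi> *\<^sub>v v)"
    using mom v by (auto simp: moment_assumption_def pos_def_def)
  moreover have "0 \<le> scalar_prod v (cov_mat P1 s \<phi> *\<^sub>v v)"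
    using cov_mat_nonneg[OF prob_spaces(2) moment_L2(2)[OF mom] v(1)] .
  ultimately show ?thesis by simp
qed

text \<open>From here on the inverse matrix enters only through the vector K and the linear system
  that it solves.\<close>

lemma K_vec_props:
  assumes mom: "moment_assumption \<mu> f0 f1 s \<phi>"
  shows "K_vec \<mu> f0 f1 s \<phi> \<in> carrier_vec s"
    "F_mat \<mu> f0 f1 s \<phi> *\<^sub>v K_vec \<mu> f0 f1 s \<phi> = Y_vec \<mu> f0 f1 s \<phi>"
proof -
  have "F_mat \<mu> f0 f1 s \<phi> \<in> carrier_mat s s" by (simp add: F_mat_def cov_mat_def)
  moreover have "Y_vec \<mu> f0 f1 s \<phi> \<in> carrier_vec s" by (simp add: Y_vec_def mean_vec_def)
  ultimately show "K_vec \<mu> f0 f1 s \<phi> \<in> carrier_vec s"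
    "F_mat \<mu> f0 f1 s \<phi> *\<^sub>v K_vec \<mu> f0 f1 s \<phi> = Y_vec \<mu> f0 f1 s \<phi>"
    unfolding K_vec_def using pos_def_mat_inverse F_mat_pos[OF mom] by blast+
qed

text \<open>By F K = Y, J is the quadratic form of F at K. Nonnegativity also makes 1 + J/2
  positive, so that it can be divided by later.\<close>

lemma J_nonneg:
  assumes mom: "moment_assumption \<mu> f0 f1 s \<phi>"
  shows "0 \<le> J s \<phi>"
proof -
  let ?K = "K_vec \<mu> f0 f1 s \<phi>"
  note K = K_vec_props[OF mom]
  have Y: "Y_vec \<mu> f0 f1 s \<phi> \<in> carrier_vec s" by (simp add: Y_vec_def mean_vec_def)
  have "J s \<phi> = scalar_prod ?K (F_mat \<mu> f0 f1 s \<phi> *\<^sub>v ?K)"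
    unfolding K(2) using comm_scalar_prod[OF Y K(1)] by (simp add: J_crit_def K_vec_def)
  also have "\<dots> \<ge> 0"
  proof (cases "?K = 0\<^sub>v s")
    case True
    then show ?thesis unfolding K(2) using Y by simp
  next
    case False
    then show ?thesis using F_mat_pos[OF mom K(1)] by simp
  qed
  finally show ?thesis .
qed

text \<open>Centring at the midpoint of the means gives \<Lambda> the means J/2 under
  \<open>f1\<close> and -J/2 under \<open>f0\<close>. Pairing F K = Y with the coefficients of q
  expresses the mean difference of q as 2 <q, \<Lambda>> minus J/2 times that same difference;
  collecting terms gives the factor 1 + J/2.\<close>

lemma Lambda_normal_equation:
  assumes mom: "moment_assumption \<mu> f0 f1 s \<phi>"
  shows "\<Lambda> s \<phi> \<in> V s \<phi>" "L2_inner m h (\<Lambda> s \<phi>) = J s \<phi> / 2"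
    "q \<in> V s \<phi> \<Longrightarrow> L2_inner m (\<Lambda> s \<phi>) q = (1 + J s \<phi> / 2) * L2_inner m h q"
proof -
  let ?K = "K_vec \<mu> f0 f1 s \<phi>" and ?Y = "Y_vec \<mu> f0 f1 s \<phi>"
  note K = K_vec_props[OF mom]
  note L2m = moment_L2[OF mom]
  define E0 where "E0 g = (\<integral>x. g x \<partial>P0)" for g :: "real \<Rightarrow> real"
  define E1 where "E1 g = (\<integral>x. g x \<partial>P1)" for g :: "real \<Rightarrow> real"
  define u where "u i = (E0 (\<phi> i) + E1 (\<phi> i)) / 2" for i
  define aff where "aff c a x = c + (\<Sum>i<s. a $ i * \<phi> i x)" for c and a :: "real Matrix.vec" and x
  have Eaff: "E0 (aff c a) = c + (\<Sum>i<s. a $ i * E0 (\<phi> i))" "E1 (aff c a) = c + (\<Sum>i<s. a $ i * E1 (\<phi> i))"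
    for c and a :: "real Matrix.vec"
  proof -
    have "(\<integral>x. aff c a x \<partial>P) = c + (\<Sum>i<s. a $ i * (\<integral>x. \<phi> i x \<partial>P))"
      if "prob_space P" and "\<And>i. i < s \<Longrightarrow> \<phi> i \<in> L2 P" for P
      unfolding aff_def using that by (rule expectation_affine)
    from this[OF prob_spaces(1) L2m(1)] this[OF prob_spaces(2) L2m(2)]
    show "E0 (aff c a) = c + (\<Sum>i<s. a $ i * E0 (\<phi> i))" "E1 (aff c a) = c + (\<Sum>i<s. a $ i * E1 (\<phi> i))"
      by (simp_all add: E0_def E1_def)
  qed
  have aff: "aff c a \<in> L2 m" "aff c a \<in> V s \<phi>" for c a
  proof -
    show "aff c a \<in> L2 m"
      unfolding aff_def by (intro L2_add L2_const L2_sum L2_scale L2m finite_mixture) auto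
    then show "aff c a \<in> V s \<phi>"
      unfolding dict_span_def by (intro CollectI conjI exI AE_I2) (simp_all add: aff_def)
  qed
  \<comment> \<open>The intercept of \<Lambda>: minus the value of the linear part at the midpoint
    of the two mean vectors.\<close>
  define c where "c = - (\<Sum>i<s. ?K $ i * u i)"
  have Lambda: "\<Lambda> s \<phi> = aff c ?K"
  proof
    show "\<Lambda> s \<phi> x = aff c ?K x" for x
      using K(1) by (simp add: Lambda_fun_def aff_def c_def scalar_prod_def mean_vec_def u_def E0_def E1_def
          right_diff_distrib sum_subtractf lessThan_atLeast0)
  qed
  show "\<Lambda> s \<phi> \<in> V s \<phi>" unfolding Lambda by (rule aff)
  \<comment> \<open>The intercept \<open>d\<close> cancels in the difference of means and may be
    chosen freely.\<close>
  have Y: "scalar_prod v ?Y = E1 (aff d v) - E0 (aff d v)" if "v \<in> carrier_vec s" for v d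
    using that by (simp add: Y_vec_def scalar_prod_def mean_vec_def Eaff E0_def[symmetric] E1_def[symmetric]
        right_diff_distrib sum_subtractf lessThan_atLeast0)
  have sum0: "E1 (aff c ?K) + E0 (aff c ?K) = 0"
    by (simp add: Eaff c_def u_def distrib_left sum.distrib add_divide_distrib flip: sum_divide_distrib)
  have "?Y \<in> carrier_vec s" by (simp add: Y_vec_def mean_vec_def)
  then have "J s \<phi> = scalar_prod ?K ?Y"
    using comm_scalar_prod[OF _ K(1)] by (simp add: J_crit_def K_vec_def)
  then have J: "J s \<phi> = E1 (aff c ?K) - E0 (aff c ?K)" using Y[OF K(1)] by simp
  show "L2_inner m h (\<Lambda> s \<phi>) = J s \<phi> / 2"
    unfolding Lambda J E0_def E1_def by (rule inner_h[OF aff(1)])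
  have main: "L2_inner m (aff c ?K) (aff d v) = (1 + J s \<phi> / 2) * L2_inner m h (aff d v)"
    if v: "v \<in> carrier_vec s" for d v
  proof -
    have C: "cov_mat P s \<phi> \<in> carrier_mat s s" for P by (simp add: cov_mat_def)
    have "E1 (aff d v) - E0 (aff d v) = scalar_prod v (F_mat \<mu> f0 f1 s \<phi> *\<^sub>v ?K)"
      unfolding K(2) by (rule Y[OF v, symmetric])
    also have "\<dots> = scalar_prod v (cov_mat P0 s \<phi> *\<^sub>v ?K) + scalar_prod v (cov_mat P1 s \<phi> *\<^sub>v ?K)"
      unfolding F_mat_def using v mult_mat_vec_carrier[OF C K(1)]
      by (simp add: add_mult_distrib_mat_vec[OF C C K(1)] scalar_prod_add_distrib[of _ s])
    also have "scalar_prod v (cov_mat P0 s \<phi> *\<^sub>v ?K)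
        = E0 (\<lambda>x. aff d v x * aff c ?K x) - E0 (aff d v) * E0 (aff c ?K)"
      unfolding E0_def aff_def by (rule cov_mat_bilinear[OF prob_spaces(1) L2m(1) v K(1)])
    also have "scalar_prod v (cov_mat P1 s \<phi> *\<^sub>v ?K)
        = E1 (\<lambda>x. aff d v x * aff c ?K x) - E1 (aff d v) * E1 (aff c ?K)"
      unfolding E1_def aff_def by (rule cov_mat_bilinear[OF prob_spaces(2) L2m(2) v K(1)])
    finally have 1: "E1 (aff d v) - E0 (aff d v)
      = E0 (\<lambda>x. aff d v x * aff c ?K x) - E0 (aff d v) * E0 (aff c ?K)
      + (E1 (\<lambda>x. aff d v x * aff c ?K x) - E1 (aff d v) * E1 (aff c ?K))" .
    have "L2_inner m (aff d v) (aff c ?K)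
      = (E0 (\<lambda>x. aff d v x * aff c ?K x) + E1 (\<lambda>x. aff d v x * aff c ?K x)) / 2"
      unfolding L2_inner_def E0_def E1_def
      using L2_D(1)[OF aff(1)] L2_mult_integrable[OF aff(1) aff(1)]
      by (intro integral_mixture) (auto simp: mixture_def)
    moreover have "L2_inner m h (aff d v) = (E1 (aff d v) - E0 (aff d v)) / 2"
      unfolding E0_def E1_def by (rule inner_h[OF aff(1)])
    moreover define t where "t = J s \<phi> / 2"
    \<comment> \<open>The two means of \<Lambda> have sum 0 by \<open>sum0\<close> and difference
      J.\<close>
    have "E1 (aff c ?K) = t" "E0 (aff c ?K) = - t"
      using sum0 J unfolding t_def by linarith+
    with 1 have "E0 (\<lambda>x. aff d v x * aff c ?K x) + E1 (\<lambda>x. aff d v x * aff c ?K x)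
      = (1 + t) * (E1 (aff d v) - E0 (aff d v))"
      by (simp add: algebra_simps)
    ultimately show ?thesis
      unfolding L2_inner_commute[of m "aff c ?K" "aff d v"] t_def
      by (simp only: times_divide_eq_right)
  qed
  assume q: "q \<in> V s \<phi>"
  then obtain d a where "AE x in m. q x = d + (\<Sum>i<s. a i * \<phi> i x)"
    by (auto simp: dict_span_def)
  \<comment> \<open>Membership in the span gives an affine form only almost everywhere; inner
    products do not see the difference.\<close>
  then have AE: "AE x in m. q x = aff d (Matrix.vec s a) x" by (simp add: aff_def)
  have eq: "L2_inner m g q = L2_inner m g (aff d (Matrix.vec s a))" if "g \<in> L2 m" for g
    using L2_inner_cong_AE[OF dict_span_D[OF q] aff(1) that AE] by (simp add: L2_inner_commute[of m g])
  show "L2_inner m (\<Lambda> s \<phi>) q = (1 + J s \<phi> / 2) * L2_inner m h q"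
    unfolding Lambda eq[OF aff(1)] eq[OF h_L2] by (rule main) simp
qed

end

section \<open>The projection of \<open>h\<close>, monotonicity and the ceiling\<close>

text \<open>Lets \<open>h\<close> itself belong to the span once it agrees almost everywhere with
  its projection.\<close>

lemma dict_span_cong_AE:
  assumes "g \<in> dict_span M s \<phi>" "h \<in> borel_measurable M" "AE x in M. h x = g x"
  shows "h \<in> dict_span M s \<phi>"
proof -
  obtain c a where "AE x in M. g x = c + (\<Sum>i<s. a i * \<phi> i x)"
    using assms by (auto simp: dict_span_def)
  with assms(3) have "AE x in M. h x = c + (\<Sum>i<s. a i * \<phi> i x)"
    by eventually_elim simp
  with L2_cong_AE[OF dict_span_D[OF assms(1)] assms(2,3)] show ?thesis
    unfolding dict_span_def by (intro CollectI conjI exI)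
qed

text \<open>For one feature, positive definiteness amounts to positive variance. This serves to
  prove it for the feature \<open>h\<close> and to refute it when the densities agree.\<close>

lemma cov_mat_1_quadratic:
  fixes v :: "real Matrix.vec"
  assumes "v \<in> carrier_vec 1"
  shows "scalar_prod v (cov_mat P 1 \<phi> *\<^sub>v v) = (v $ 0)\<^sup>2 * (\<integral>x. (\<phi> 0 x - (\<integral>y. \<phi> 0 y \<partial>P))\<^sup>2 \<partial>P)"
  using assms by (simp add: scalar_prod_def cov_mat_def power2_eq_square)

text \<open>The map x to 2x/(1 - x) is strictly increasing below 1, so inequalities and their
  equality cases pass from squared norms to J.\<close>

lemma odds_mono:
  fixes x y :: real
  assumes "x \<le> y" "y < 1"
  shows "2 * x / (1 - x) \<le> 2 * y / (1 - y)" "2 * x / (1 - x) = 2 * y / (1 - y) \<longleftrightarrow> x = y"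
  using assms by (auto simp: field_simps)

context two_densities
begin

text \<open>An explicit representative of the projection of \<open>h\<close>, read off from the
  normal equation. It supplies the existence that the choice in \<open>L2_proj\<close> depends
  on.\<close>

definition proj_h :: "nat \<Rightarrow> (nat \<Rightarrow> real \<Rightarrow> real) \<Rightarrow> real \<Rightarrow> real" where
  "proj_h s \<phi> x = inverse (1 + J s \<phi> / 2) * \<Lambda> s \<phi> x"

definition N :: "nat \<Rightarrow> (nat \<Rightarrow> real \<Rightarrow> real) \<Rightarrow> real" where
  "N s \<phi> = L2_inner m (proj_h s \<phi>) (proj_h s \<phi>)"

lemma proj_h_in: "moment_assumption \<mu> f0 f1 s \<phi> \<Longrightarrow> proj_h s \<phi> \<in> V s \<phi>"
  unfolding proj_h_def by (intro dict_span_scale Lambda_normal_equation)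

text \<open>The normal equation divided by 1 + J/2 > 0; it says that \<open>h\<close> minus
  \<open>proj_h\<close> is orthogonal to the span.\<close>

lemma proj_h_inner:
  assumes mom: "moment_assumption \<mu> f0 f1 s \<phi>" and q: "q \<in> V s \<phi>"
  shows "L2_inner m (proj_h s \<phi>) q = L2_inner m h q"
proof -
  have "L2_inner m (proj_h s \<phi>) q = inverse (1 + J s \<phi> / 2) * L2_inner m (\<Lambda> s \<phi>) q"
    unfolding proj_h_def by (rule L2_inner_scale)
  then show ?thesis
    using Lambda_normal_equation(3)[OF mom q] J_nonneg[OF mom] by (simp flip: mult.assoc)
qed

lemma inner_h_proj_h:
  assumes "moment_assumption \<mu> f0 f1 s \<phi>"
  shows "L2_inner m h (proj_h s \<phi>) = N s \<phi>"
  unfolding N_def using proj_h_inner[OF assms proj_h_in[OF assms]] by simp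

text \<open>Pairing \<open>proj_h\<close> with \<open>h\<close> gives N = (J/2)/(1 + J/2), which is
  below 1; solving for J gives the second identity.\<close>

lemma N_props:
  assumes mom: "moment_assumption \<mu> f0 f1 s \<phi>"
  shows "N s \<phi> < 1" "J s \<phi> = 2 * N s \<phi> / (1 - N s \<phi>)"
proof -
  have "N s \<phi> = L2_inner m (proj_h s \<phi>) h"
    using inner_h_proj_h[OF mom] L2_inner_commute[of m h "proj_h s \<phi>"] by simp
  also have "\<dots> = inverse (1 + J s \<phi> / 2) * L2_inner m (\<Lambda> s \<phi>) h"
    unfolding proj_h_def by (rule L2_inner_scale)
  also have "L2_inner m (\<Lambda> s \<phi>) h = J s \<phi> / 2"
    using Lambda_normal_equation(2)[OF mom] L2_inner_commute[of m h "\<Lambda> s \<phi>"] by simp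
  finally have N: "N s \<phi> = J s \<phi> / (2 + J s \<phi>)"
    using J_nonneg[OF mom] by (simp add: field_simps)
  then show "N s \<phi> < 1" using J_nonneg[OF mom] by simp
  have "1 - N s \<phi> = 2 / (2 + J s \<phi>)" unfolding N using J_nonneg[OF mom] by (simp add: field_simps)
  then show "J s \<phi> = 2 * N s \<phi> / (1 - N s \<phi>)"
    unfolding N using J_nonneg[OF mom] by simp
qed

text \<open>The choice operator may return a representative p other than \<open>proj_h\<close>. Both
  have the same inner products with the span as \<open>h\<close>, and both lie in it, so <p, p> =
  <\<open>proj_h\<close>, p> = N.\<close>

lemma norm_L2_proj:
  assumes mom: "moment_assumption \<mu> f0 f1 s \<phi>"
  shows "(L2_norm m (L2_proj m (V s \<phi>) h))\<^sup>2 = N s \<phi>"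
proof -
  define p where "p = L2_proj m (V s \<phi>) h"
  have "\<exists>p. p \<in> V s \<phi> \<and> (\<forall>q\<in>V s \<phi>. L2_inner m (\<lambda>x. h x - p x) q = 0)"
    using proj_h_in[OF mom] proj_h_inner[OF mom]
    by (auto intro!: exI[of _ "proj_h s \<phi>"] simp: L2_inner_diff h_L2 dict_span_D)
  then have "p \<in> V s \<phi> \<and> (\<forall>q\<in>V s \<phi>. L2_inner m (\<lambda>x. h x - p x) q = 0)"
    unfolding p_def L2_proj_def by (rule someI_ex)
  then have p: "p \<in> V s \<phi>" and ph: "\<And>q. q \<in> V s \<phi> \<Longrightarrow> L2_inner m p q = L2_inner m h q"
    by (auto simp: L2_inner_diff h_L2 dict_span_D)
  have "L2_inner m p p = L2_inner m (proj_h s \<phi>) p"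
    by (simp add: ph p proj_h_inner[OF mom])
  also have "\<dots> = L2_inner m p (proj_h s \<phi>)" by (rule L2_inner_commute)
  also have "\<dots> = N s \<phi>"
    by (simp add: ph proj_h_in[OF mom] inner_h_proj_h[OF mom])
  finally show ?thesis by (simp add: L2_norm_sq p_def)
qed

text \<open>Pythagoras, with \<Delta>/2 as the squared norm of \<open>h\<close>.\<close>

lemma dist_proj_h:
  assumes mom: "moment_assumption \<mu> f0 f1 s \<phi>"
  shows "L2_inner m (\<lambda>x. h x - proj_h s \<phi> x) (\<lambda>x. h x - proj_h s \<phi> x) = \<Delta> / 2 - N s \<phi>"
  using L2_inner_diff_diff[OF h_L2 dict_span_D[OF proj_h_in[OF mom]]] inner_h_proj_h[OF mom]
  by (simp add: inner_h_h N_def)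

text \<open>The squared distance from \<open>proj_h\<close> to q is nonnegative and, by
  orthogonality, equals the squared distance from \<open>h\<close> to q minus \<Delta>/2 - N.
  Monotonicity, the equality case and the limit all rest on this.\<close>

lemma best_approximation:
  assumes mom: "moment_assumption \<mu> f0 f1 s \<phi>" and q: "q \<in> V s \<phi>"
  shows "\<Delta> / 2 - N s \<phi> \<le> L2_inner m (\<lambda>x. h x - q x) (\<lambda>x. h x - q x)"
proof -
  have "0 \<le> L2_inner m (\<lambda>x. proj_h s \<phi> x - q x) (\<lambda>x. proj_h s \<phi> x - q x)"
    by (rule L2_inner_nonneg)
  also have "\<dots> = N s \<phi> - 2 * L2_inner m h q + L2_inner m q q"
    using dict_span_D[OF q] dict_span_D[OF proj_h_in[OF mom]]
    by (simp add: L2_inner_diff_diff proj_h_inner[OF mom q] N_def)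
  finally show ?thesis
    using dict_span_D[OF q] by (simp add: L2_inner_diff_diff h_L2 inner_h_h)
qed

text \<open>The projection onto the smaller span is a competitor in the larger one, so the distance
  to \<open>h\<close> cannot grow.\<close>

lemma N_mono:
  assumes "moment_assumption \<mu> f0 f1 s \<phi>" "moment_assumption \<mu> f0 f1 s' \<psi>" "V s \<phi> \<subseteq> V s' \<psi>"
  shows "N s \<phi> \<le> N s' \<psi>"
  using best_approximation[OF assms(2) subsetD[OF assms(3) proj_h_in[OF assms(1)]]]
  by (simp add: dist_proj_h[OF assms(1)])

lemma N_le_iff:
  assumes mom: "moment_assumption \<mu> f0 f1 s \<phi>"
  shows "N s \<phi> \<le> \<Delta> / 2" "N s \<phi> = \<Delta> / 2 \<longleftrightarrow> h \<in> V s \<phi>"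
proof -
  let ?d = "\<lambda>x. h x - proj_h s \<phi> x"
  note p = proj_h_in[OF mom]
  show le: "N s \<phi> \<le> \<Delta> / 2" using L2_inner_nonneg[of m ?d] by (simp add: dist_proj_h[OF mom])
  show "N s \<phi> = \<Delta> / 2 \<longleftrightarrow> h \<in> V s \<phi>"
  proof
    assume "N s \<phi> = \<Delta> / 2"
    then have "L2_inner m ?d ?d = 0" by (simp add: dist_proj_h[OF mom])
    then have "AE x in m. h x = proj_h s \<phi> x"
      by (subst (asm) L2_inner_eq_0_iff) (auto intro: L2_diff h_L2 dict_span_D p)
    then show "h \<in> V s \<phi>" by (intro dict_span_cong_AE[OF p] L2_D(1)[OF h_L2])
  next
    assume "h \<in> V s \<phi>"
    \<comment> \<open>Here \<open>h\<close> is its own competitor, at distance 0.\<close>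
    from best_approximation[OF mom this] le show "N s \<phi> = \<Delta> / 2"
      by (simp add: L2_inner_def)
  qed
qed

lemma J_mono:
  assumes "moment_assumption \<mu> f0 f1 s \<phi>" "moment_assumption \<mu> f0 f1 s' \<psi>" "V s \<phi> \<subseteq> V s' \<psi>"
  shows "J s \<phi> \<le> J s' \<psi>"
  unfolding N_props(2)[OF assms(1)] N_props(2)[OF assms(2)]
  by (intro odds_mono N_mono N_props(1) assms)

text \<open>Writes the ceiling as 2x/(1 - x) at x = \<Delta>/2, the form in which
  \<open>odds_mono\<close> compares it with J.\<close>

lemma ceiling_eq: "\<Delta> < 2 \<Longrightarrow> ceiling_J \<mu> f0 f1 = ereal (2 * (\<Delta> / 2) / (1 - \<Delta> / 2))"
  by (simp add: ceiling_J_def field_simps)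

lemma moment_triangular_less_2: "moment_assumption \<mu> f0 f1 s \<phi> \<Longrightarrow> \<Delta> < 2"
  by (rule triangular_less_2) (simp add: moment_assumption_def)

lemma J_le_ceiling:
  assumes mom: "moment_assumption \<mu> f0 f1 s \<phi>"
  shows "ereal (J s \<phi>) \<le> ceiling_J \<mu> f0 f1" "ereal (J s \<phi>) = ceiling_J \<mu> f0 f1 \<longleftrightarrow> h \<in> V s \<phi>"
proof -
  note lt = moment_triangular_less_2[OF mom]
  from lt have "\<Delta> / 2 < 1" by simp
  note odds = odds_mono[OF N_le_iff(1)[OF mom] this]
  show "ereal (J s \<phi>) \<le> ceiling_J \<mu> f0 f1"
    unfolding ceiling_eq[OF lt] N_props(2)[OF mom] ereal_less_eq by (rule odds)
  show "ereal (J s \<phi>) = ceiling_J \<mu> f0 f1 \<longleftrightarrow> h \<in> V s \<phi>"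
    unfolding ceiling_eq[OF lt] N_props(2)[OF mom] ereal.inject odds(2) by (rule N_le_iff(2)[OF mom])
qed

section \<open>The single feature \<open>h\<close> and the case of equal densities\<close>

lemma integral_f: "integrable \<mu> f0" "integrable \<mu> f1" "(\<integral>x. f0 x \<partial>\<mu>) = 1" "(\<integral>x. f1 x \<partial>\<mu>) = 1"
proof -
  interpret P0: prob_space P0 by (rule prob_spaces)
  interpret P1: prob_space P1 by (rule prob_spaces)
  show "integrable \<mu> f0" "integrable \<mu> f1"
    using integrable_iff(1,2)[of "\<lambda>_. 1"] by auto
  show "(\<integral>x. f0 x \<partial>\<mu>) = 1" "(\<integral>x. f1 x \<partial>\<mu>) = 1"
    using integral_density[of "\<lambda>_. 1 :: real" \<mu> f0] integral_density[of "\<lambda>_. 1 :: real" \<mu> f1]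
      AE_f_nonneg P0.prob_space P1.prob_space by auto
qed

text \<open>If \<open>h\<close> had variance 0 under \<open>f0\<close>, it would be a constant e
  there, so that \<open>f1 - f0\<close> is e times \<open>f1 + f0\<close>. Integrating forces e = 0,
  hence equal densities. Otherwise the feature is admissible, and its span contains
  \<open>h\<close>.\<close>

lemma h_feature:
  assumes van: "vanishes_with \<mu> f0 f1" and ne: "\<not> (AE x in \<mu>. f0 x = f1 x)"
  shows "moment_assumption \<mu> f0 f1 1 (\<lambda>_. h)"
    "ereal (J 1 (\<lambda>_. h)) = ceiling_J \<mu> f0 f1"
proof -
  interpret P0: prob_space P0 by (rule prob_spaces)
  have h: "h \<in> L2 P0" "h \<in> L2 P1" using h_L2 by (auto simp: L2_mixture_iff)
  define e where "e = (\<integral>y. h y \<partial>P0)"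
  define w where "w = (\<integral>x. (h x - e)\<^sup>2 \<partial>P0)"
  have L2: "(\<lambda>x. h x - e) \<in> L2 P0"
    by (intro L2_diff L2_const h P0.finite_measure_axioms)
  have "w \<noteq> 0"
  proof
    assume "w = 0"
    then have "AE x in P0. h x - e = 0"
      using L2_D(2)[OF L2] unfolding w_def by (subst (asm) integral_nonneg_eq_0_iff_AE) auto
    then have "AE x in \<mu>. 0 < ennreal (f0 x) \<longrightarrow> h x - e = 0"
      by (subst (asm) AE_density) auto
    \<comment> \<open>Where \<open>f0\<close> vanishes, constancy under \<open>P0\<close> says
      nothing, but \<open>f1\<close> vanishes too and both sides are 0.\<close>
    then have AE: "AE x in \<mu>. f1 x - f0 x = e * (f1 x + f0 x)"
      using van[unfolded vanishes_with_def] AE_f_nonneg(1,2)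
      by eventually_elim (auto simp: h_star_def less_le field_simps)
    have "(\<integral>x. f1 x - f0 x \<partial>\<mu>) = (\<integral>x. e * (f1 x + f0 x) \<partial>\<mu>)"
      using AE by (intro integral_cong_AE) auto
    \<comment> \<open>Both densities have mass 1, so the equation of integrals is 0 = 2e.\<close>
    then have "e = 0" using integral_f by simp
    from AE have "AE x in \<mu>. f0 x = f1 x" by eventually_elim (simp add: \<open>e = 0\<close>)
    with ne show False ..
  qed
  moreover have "0 \<le> w" unfolding w_def by simp
  ultimately have "w > 0" by simp
  then have "0 < scalar_prod v (cov_mat P0 1 (\<lambda>_. h) *\<^sub>v v)"
    if "v \<in> carrier_vec 1" "v \<noteq> 0\<^sub>v 1" for v
  proof -
    have "v $ 0 \<noteq> 0" using that by (auto simp: eq_vecI)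
    then show ?thesis unfolding cov_mat_1_quadratic[OF that(1)] using \<open>w > 0\<close> by (simp add: w_def e_def)
  qed
  moreover have "transpose_mat (cov_mat P0 1 (\<lambda>_. h)) = cov_mat P0 1 (\<lambda>_. h)"
    by (rule eq_matI) (auto simp: cov_mat_def)
  ultimately have "pos_def 1 (cov_mat P0 1 (\<lambda>_. h))"
    by (auto simp: pos_def_def cov_mat_def)
  then show mom: "moment_assumption \<mu> f0 f1 1 (\<lambda>_. h)"
    using h van unfolding moment_assumption_def by (auto simp: L2_def)
  have "h \<in> V 1 (\<lambda>_. h)"
    using h_L2 by (auto simp: dict_span_def intro!: exI[of _ 0] exI[of _ "\<lambda>_. 1"])
  then show "ereal (J 1 (\<lambda>_. h)) = ceiling_J \<mu> f0 f1"
    using J_le_ceiling(2)[OF mom] by simp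
qed

text \<open>Here \<open>h\<close> is almost everywhere 0, so its variance is 0 and positive
  definiteness fails. Moreover \<Delta> = 0, and J is squeezed between 0 and the ceiling 0.\<close>

lemma equal_densities:
  assumes eq: "AE x in \<mu>. f0 x = f1 x"
  shows "AE x in \<mu>. h x = 0" "\<not> moment_assumption \<mu> f0 f1 1 (\<lambda>_. h)" "ceiling_J \<mu> f0 f1 = 0"
    "moment_assumption \<mu> f0 f1 s \<phi> \<Longrightarrow> ereal (J s \<phi>) = ceiling_J \<mu> f0 f1"
proof -
  show h0: "AE x in \<mu>. h x = 0"
    using eq by eventually_elim (simp add: h_star_def)
  then have "AE x in P0. h x = 0" by (subst AE_density) auto
  then have "(\<integral>y. h y \<partial>P0) = 0" "(\<integral>x. (h x - 0)\<^sup>2 \<partial>P0) = 0"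
    by (auto intro!: integral_eq_zero_AE)
  then have var: "(\<integral>x. (h x - (\<integral>y. h y \<partial>P0))\<^sup>2 \<partial>P0) = 0" by simp
  show "\<not> moment_assumption \<mu> f0 f1 1 (\<lambda>_. h)"
  proof
    assume "moment_assumption \<mu> f0 f1 1 (\<lambda>_. h)"
    moreover define v :: "real Matrix.vec" where "v = Matrix.vec 1 (\<lambda>_. 1)"
    have "v \<in> carrier_vec 1" "v \<noteq> 0\<^sub>v 1"
      unfolding v_def by (auto dest: arg_cong[of _ _ "\<lambda>v. v $ 0"])
    ultimately have "0 < scalar_prod v (cov_mat P0 1 (\<lambda>_. h) *\<^sub>v v)"
      by (auto simp: moment_assumption_def pos_def_def)
    then show False
      unfolding cov_mat_1_quadratic[OF \<open>v \<in> carrier_vec 1\<close>] var by simp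
  qed
  have "\<Delta> = 0"
    unfolding triangular_def using eq by (intro integral_eq_zero_AE) (auto elim: eventually_mono)
  then show c: "ceiling_J \<mu> f0 f1 = 0" by (simp add: ceiling_J_def)
  assume "moment_assumption \<mu> f0 f1 s \<phi>"
  from J_nonneg[OF this] J_le_ceiling(1)[OF this] show "ereal (J s \<phi>) = ceiling_J \<mu> f0 f1"
    by (simp add: c)
qed

section \<open>The limit along a dense nested sequence of spans\<close>

text \<open>Density puts some q of one span close to \<open>h\<close>; nestedness keeps q in all
  later spans, so best approximation gives N \<longlonglongrightarrow> \<Delta>/2. Since \<Delta>/2
  < 1, the limit of J follows by continuity. For \<Lambda>, the squared distance to its limit is a
  polynomial in J.\<close>

lemma dense_limit:
  assumes mom: "\<And>s. 1 \<le> s \<Longrightarrow> moment_assumption \<mu> f0 f1 s (\<Phi> s)"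
    and nested: "\<And>s. 1 \<le> s \<Longrightarrow> V s (\<Phi> s) \<subseteq> V (s + 1) (\<Phi> (s + 1))"
    and dense: "\<And>g \<epsilon>. g \<in> L2 m \<Longrightarrow> 0 < \<epsilon> \<Longrightarrow> \<exists>q\<in>(\<Union>s\<in>{1..}. V s (\<Phi> s)). L2_norm m (\<lambda>x. g x - q x) < \<epsilon>"
  shows "(\<lambda>s. J s (\<Phi> s)) \<longlonglongrightarrow> 2 * \<Delta> / (2 - \<Delta>)"
    "L2_tendsto m (\<lambda>s. \<Lambda> s (\<Phi> s)) (\<lambda>x. 2 * h x / (2 - \<Delta>))"
proof -
  have lt: "\<Delta> < 2" by (rule moment_triangular_less_2[OF mom[OF order_refl]])
  have mono: "V s (\<Phi> s) \<subseteq> V n (\<Phi> n)" if "1 \<le> s" "s \<le> n" for s n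
    using that(2)
  proof (induction n rule: dec_induct)
    case (step n)
    with nested[of n] that(1) show ?case by auto
  qed simp
  \<comment> \<open>Nothing is assumed about the dictionary of order 0, so identities between
    sequences hold only eventually.\<close>
  have ev: "eventually (\<lambda>s. 1 \<le> s) sequentially" by (rule eventually_ge_at_top)
  have N: "(\<lambda>s. N s (\<Phi> s)) \<longlonglongrightarrow> \<Delta> / 2"
  proof (rule LIMSEQ_I)
    fix r :: real assume "0 < r"
    \<comment> \<open>N is a squared norm, so accuracy r for it calls for distance sqrt r.\<close>
    with dense[OF h_L2, of "sqrt r"] obtain s q where s: "1 \<le> s" and q: "q \<in> V s (\<Phi> s)"
      and d: "L2_norm m (\<lambda>x. h x - q x) < sqrt r" by auto
    from d have d: "L2_inner m (\<lambda>x. h x - q x) (\<lambda>x. h x - q x) < r"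
      by (simp add: L2_norm_def)
    have "norm (N n (\<Phi> n) - \<Delta> / 2) < r" if "s \<le> n" for n
    proof -
      have n: "moment_assumption \<mu> f0 f1 n (\<Phi> n)" using mom s that by simp
      have "q \<in> V n (\<Phi> n)" using mono[OF s that] q by auto
      from best_approximation[OF n this] N_le_iff(1)[OF n] d show ?thesis by simp
    qed
    then show "\<exists>n0. \<forall>n\<ge>n0. norm (N n (\<Phi> n) - \<Delta> / 2) < r" by blast
  qed
  have "(\<lambda>s. 2 * N s (\<Phi> s) / (1 - N s (\<Phi> s))) \<longlonglongrightarrow> 2 * (\<Delta> / 2) / (1 - \<Delta> / 2)"
    using lt by (intro tendsto_intros N) auto
  also have "2 * (\<Delta> / 2) / (1 - \<Delta> / 2) = 2 * \<Delta> / (2 - \<Delta>)"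
    using lt by (simp add: field_simps)
  finally show J: "(\<lambda>s. J s (\<Phi> s)) \<longlonglongrightarrow> 2 * \<Delta> / (2 - \<Delta>)"
    by (rule Lim_transform_eventually) (use ev in eventually_elim, simp add: N_props(2)[OF mom])
  \<comment> \<open>This is the limit of 1 + J/2, the factor between \<Lambda> and the projection of
    \<open>h\<close>.\<close>
  define c where "c = 2 / (2 - \<Delta>)"
  have ch: "(\<lambda>x. c * h x) \<in> L2 m" by (intro L2_scale h_L2)
  \<comment> \<open>The sequence is the expanded squared distance from \<Lambda> to c
    \<open>h\<close>, by the normal equation with q = \<Lambda>. In the limit its terms are 1, -2
    and 1 times the squared norm of c \<open>h\<close>.\<close>
  have "(\<lambda>s. (1 + J s (\<Phi> s) / 2) * (J s (\<Phi> s) / 2) - 2 * (c * (J s (\<Phi> s) / 2)) + c * (c * (\<Delta> / 2)))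
    \<longlonglongrightarrow> (1 + (2 * \<Delta> / (2 - \<Delta>)) / 2) * ((2 * \<Delta> / (2 - \<Delta>)) / 2)
        - 2 * (c * ((2 * \<Delta> / (2 - \<Delta>)) / 2)) + c * (c * (\<Delta> / 2))"
    by (intro tendsto_intros J) auto
  also have "1 + (2 * \<Delta> / (2 - \<Delta>)) / 2 = c" using lt by (simp add: c_def field_simps)
  also have "(2 * \<Delta> / (2 - \<Delta>)) / 2 = c * (\<Delta> / 2)" by (simp add: c_def)
  finally have lim: "(\<lambda>s. (1 + J s (\<Phi> s) / 2) * (J s (\<Phi> s) / 2) - 2 * (c * (J s (\<Phi> s) / 2)) + c * (c * (\<Delta> / 2)))
    \<longlonglongrightarrow> 0" by simp
  have "(\<lambda>s. L2_inner m (\<lambda>x. \<Lambda> s (\<Phi> s) x - c * h x) (\<lambda>x. \<Lambda> s (\<Phi> s) x - c * h x)) \<longlonglongrightarrow> 0"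
  proof (rule Lim_transform_eventually[OF lim])
    show "\<forall>\<^sub>F s in sequentially. (1 + J s (\<Phi> s) / 2) * (J s (\<Phi> s) / 2) - 2 * (c * (J s (\<Phi> s) / 2)) + c * (c * (\<Delta> / 2))
      = L2_inner m (\<lambda>x. \<Lambda> s (\<Phi> s) x - c * h x) (\<lambda>x. \<Lambda> s (\<Phi> s) x - c * h x)"
      using ev
    proof eventually_elim
      case (elim s)
      note L = Lambda_normal_equation[OF mom[OF elim]]
      show ?case
        using L2_inner_diff_diff[OF dict_span_D[OF L(1)] ch] L(3)[OF L(1)] L(2)
          L2_inner_commute[of m "\<Lambda> s (\<Phi> s)" "\<lambda>x. c * h x"] L2_inner_commute[of m h "\<lambda>x. c * h x"]
        by (simp add: L2_inner_scale inner_h_h)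
    qed
  qed
  from tendsto_real_sqrt[OF this]
  have "(\<lambda>s. L2_norm m (\<lambda>x. \<Lambda> s (\<Phi> s) x - c * h x)) \<longlonglongrightarrow> 0" by (simp add: L2_norm_def)
  moreover have "\<forall>\<^sub>F s in sequentially. \<Lambda> s (\<Phi> s) \<in> L2 m"
    using ev by eventually_elim (rule dict_span_D[OF Lambda_normal_equation(1)[OF mom]])
  ultimately have "L2_tendsto m (\<lambda>s. \<Lambda> s (\<Phi> s)) (\<lambda>x. c * h x)"
    using ch by (simp add: L2_tendsto_def)
  moreover have "(\<lambda>x. c * h x) = (\<lambda>x. 2 * h x / (2 - \<Delta>))" by (simp add: c_def)
  ultimately show "L2_tendsto m (\<lambda>s. \<Lambda> s (\<Phi> s)) (\<lambda>x. 2 * h x / (2 - \<Delta>))" by simp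
qed

end

section \<open>Bernoulli pairs and numerical bounds\<close>

text \<open>The embedding of the truth values into the reals is injective, so each point keeps its
  own mass.\<close>

lemma bernoulli_density_simps:
  assumes "0 \<le> p" "p \<le> 1"
  shows "bernoulli_density p 1 = p" "bernoulli_density p 0 = 1 - p"
proof -
  have inj: "inj (of_bool :: bool \<Rightarrow> real)" by (auto simp: inj_def)
  show "bernoulli_density p 1 = p" "bernoulli_density p 0 = 1 - p"
    using pmf_map_inj'[OF inj, of "bernoulli_pmf p" True] pmf_map_inj'[OF inj, of "bernoulli_pmf p" False] assms
    by (simp_all add: bernoulli_density_def)
qed

lemma prob_density_bernoulli:
  assumes "0 \<le> p" "p \<le> 1"
  shows "prob_density (count_space {0, 1}) (bernoulli_density p)"
proof -
  have "emeasure (density (count_space {0, 1}) (bernoulli_density p)) {0, 1}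
    = (\<Sum>x\<in>{0, 1}. ennreal (bernoulli_density p x))"
    by (subst emeasure_density) (auto simp: nn_integral_count_space_finite)
  also have "\<dots> = ennreal (1 - p) + ennreal p"
    using assms by (simp add: bernoulli_density_simps)
  also have "\<dots> = 1"
    using assms by (simp flip: ennreal_plus)
  finally show ?thesis
    by (auto simp: prob_density_def bernoulli_density_def intro!: prob_spaceI)
qed

text \<open>For the parameters p and 1 - p the densities add up to 1 at both points and differ there
  by 1 - 2p in absolute value. Exchanging the points exchanges the densities, so the two divergences
  coincide.\<close>

lemma bernoulli_reflection:
  fixes p :: real
  assumes p: "0 < p" "p < 1"
  defines "\<mu> \<equiv> count_space {0, 1 :: real}" and "f0 \<equiv> bernoulli_density p" and "f1 \<equiv> bernoulli_density (1 - p)"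
  shows "density_pair \<mu> f0 f1" "vanishes_with \<mu> f0 f1"
    "ceiling_J \<mu> f0 f1 = ereal (2 * (1 - 2 * p)\<^sup>2 / (1 - (1 - 2 * p)\<^sup>2))"
    "sym_div \<mu> f0 f1 = ereal (2 * (1 - 2 * p) * ln ((1 - p) / p))"
proof -
  have f: "f0 1 = p" "f0 0 = 1 - p" "f1 1 = 1 - p" "f1 0 = p"
    using p by (simp_all add: f0_def f1_def bernoulli_density_simps)
  show "density_pair \<mu> f0 f1"
    unfolding density_pair_def \<mu>_def f0_def f1_def using p by (auto intro!: prob_density_bernoulli)
  show "vanishes_with \<mu> f0 f1"
    using p by (simp add: vanishes_with_def \<mu>_def AE_count_space f)
  have "triangular \<mu> f0 f1 = 2 * (1 - 2 * p)\<^sup>2"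
    by (simp add: triangular_def \<mu>_def lebesgue_integral_count_space_finite f power2_eq_square algebra_simps)
  \<comment> \<open>This excludes \<Delta> = 2, the infinite branch of
    \<open>ceiling_J\<close>.\<close>
  moreover have "(1 - 2 * p)\<^sup>2 < 1"
    using p by (simp add: abs_square_less_1 abs_less_iff)
  ultimately show "ceiling_J \<mu> f0 f1 = ereal (2 * (1 - 2 * p)\<^sup>2 / (1 - (1 - 2 * p)\<^sup>2))"
    by (simp add: ceiling_J_def field_simps)
  have "ln (p / (1 - p)) = - ln ((1 - p) / p)" using p by (simp add: ln_div)
  then show "sym_div \<mu> f0 f1 = ereal (2 * (1 - 2 * p) * ln ((1 - p) / p))"
    using p by (simp add: sym_div_def KL_div_def \<mu>_def AE_count_space f
        lebesgue_integral_count_space_finite integrable_count_space algebra_simps)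
qed

text \<open>Writing 4 as a power of 2, and 99 as 99/64 times \<open>2 ^ 6\<close>, leaves arguments
  close to 1, for which few terms of the series bound suffice. The lower bound for
  \<open>ln 4\<close> has to be sharp: \<open>1.2 * ln 4\<close> must exceed 1.6635.\<close>

lemma ln_bounds: "ln 4 \<in> {1.38626..1.3863 :: real}" "ln 99 \<in> {4.595..4.5952 :: real}"
proof -
  have 2: "0.693133 \<le> ln (2 :: real)" "ln (2 :: real) \<le> 0.69315"
    using ln_approx_bounds[of 2 4] by (simp_all add: eval_nat_numeral)
  have 64: "0.43621 \<le> ln (99 / 64 :: real)" "ln (99 / 64 :: real) \<le> 0.43625"
    using ln_approx_bounds[of "99/64" 3] by (simp_all add: eval_nat_numeral)
  have "ln (4 :: real) = 2 * ln 2" using ln_realpow[of 2 2] by simp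
  moreover have "ln (99 :: real) = ln (99 / 64) + 6 * ln 2"
    using ln_realpow[of 2 6] ln_mult[of "99 / 64 :: real" 64] by simp
  ultimately show "ln 4 \<in> {1.38626..1.3863 :: real}" "ln 99 \<in> {4.595..4.5952 :: real}"
    using 2 64 by auto
qed

theorem theorem3p2:
  shows "(\<forall>\<mu> f0 f1. density_pair \<mu> f0 f1 \<longrightarrow>
    \<comment> \<open>(a)\<close>
    (\<forall>s\<ge>1. \<forall>\<phi> \<psi>.
        moment_assumption \<mu> f0 f1 s \<phi> \<and> moment_assumption \<mu> f0 f1 (s + 1) \<psi> \<and>
        dict_span (mixture \<mu> f0 f1) s \<phi> \<subseteq> dict_span (mixture \<mu> f0 f1) (s + 1) \<psi> \<longrightarrow>
        J_crit \<mu> f0 f1 (s + 1) \<psi> \<ge> J_crit \<mu> f0 f1 s \<phi>) \<and>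
    \<comment> \<open>(b)\<close>
    (\<forall>s\<ge>1. \<forall>\<phi>. moment_assumption \<mu> f0 f1 s \<phi> \<longrightarrow>
       (let m = mixture \<mu> f0 f1; V = dict_span m s \<phi>; h = h_star f0 f1;
            N = (L2_norm m (L2_proj m V h))\<^sup>2; J = J_crit \<mu> f0 f1 s \<phi>
        in N < 1 \<and> J = 2 * N / (1 - N) \<and>
           ereal J \<le> ceiling_J \<mu> f0 f1 \<and>
           (ereal J = ceiling_J \<mu> f0 f1 \<longleftrightarrow> h \<in> V))) \<and>
    (vanishes_with \<mu> f0 f1 \<and> \<not> (AE x in \<mu>. f0 x = f1 x) \<longrightarrow>
       moment_assumption \<mu> f0 f1 1 (\<lambda>_. h_star f0 f1) \<and>
       ereal (J_crit \<mu> f0 f1 1 (\<lambda>_. h_star f0 f1)) = ceiling_J \<mu> f0 f1) \<and>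
    ((AE x in \<mu>. f0 x = f1 x) \<longrightarrow>
       (AE x in \<mu>. h_star f0 f1 x = 0) \<and>
       \<not> moment_assumption \<mu> f0 f1 1 (\<lambda>_. h_star f0 f1) \<and>
       ceiling_J \<mu> f0 f1 = 0 \<and>
       (\<forall>s\<ge>1. \<forall>\<phi>. moment_assumption \<mu> f0 f1 s \<phi> \<longrightarrow>
          ereal (J_crit \<mu> f0 f1 s \<phi>) = ceiling_J \<mu> f0 f1)) \<and>
    (\<forall>\<Phi>. let m = mixture \<mu> f0 f1; \<Delta> = triangular \<mu> f0 f1; V = (\<lambda>s. dict_span m s (\<Phi> s)) in
       \<Delta> < 2 \<and>
       (\<forall>s\<ge>1. moment_assumption \<mu> f0 f1 s (\<Phi> s) \<and> V s \<subseteq> V (s + 1)) \<and>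
       (\<forall>g\<in>L2 m. \<forall>\<epsilon>>0. \<exists>h\<in>(\<Union>s\<in>{1..}. V s). L2_norm m (\<lambda>x. g x - h x) < \<epsilon>) \<longrightarrow>
         (\<forall>s\<ge>1. J_crit \<mu> f0 f1 s (\<Phi> s) \<le> J_crit \<mu> f0 f1 (s + 1) (\<Phi> (s + 1))) \<and>
         (\<lambda>s. J_crit \<mu> f0 f1 s (\<Phi> s)) \<longlonglongrightarrow> 2 * \<Delta> / (2 - \<Delta>) \<and>
         L2_tendsto m (\<lambda>s. Lambda_fun \<mu> f0 f1 s (\<Phi> s))
           (\<lambda>x. 2 * h_star f0 f1 x / (2 - \<Delta>)))) \<and>
    \<comment> \<open>(c)\<close>
    \<not> (\<forall>\<mu> f0 f1. density_pair \<mu> f0 f1 \<and> vanishes_with \<mu> f0 f1 \<longrightarrow>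
          ceiling_J \<mu> f0 f1 \<le> sym_div \<mu> f0 f1) \<and>
    \<not> (\<forall>\<mu> f0 f1. density_pair \<mu> f0 f1 \<and> vanishes_with \<mu> f0 f1 \<longrightarrow>
          sym_div \<mu> f0 f1 \<le> ceiling_J \<mu> f0 f1) \<and>
    (let \<mu> = count_space {0, 1}; f0 = bernoulli_density 0.01; f1 = bernoulli_density 0.99 in
       ceiling_J \<mu> f0 f1 = ereal (0.98\<^sup>2 / 0.0198) \<and> \<bar>0.98\<^sup>2 / 0.0198 - 48.5 :: real\<bar> < 0.05 \<and>
       sym_div \<mu> f0 f1 = ereal (1.96 * ln 99) \<and> \<bar>1.96 * ln 99 - 9.01 :: real\<bar> < 0.005) \<and>
    (let \<mu> = count_space {0, 1}; f0 = bernoulli_density 0.2; f1 = bernoulli_density 0.8 in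
       ceiling_J \<mu> f0 f1 = ereal (0.36 / 0.32) \<and> (0.36 / 0.32 :: real) = 1.125 \<and>
       sym_div \<mu> f0 f1 = ereal (1.2 * ln 4) \<and> \<bar>1.2 * ln 4 - 1.664 :: real\<bar> < 0.0005)"
proof (intro conjI allI impI)
  fix \<mu> f0 f1
  assume "density_pair \<mu> f0 f1"
  then interpret two_densities \<mu> f0 f1
    by unfold_locales (auto simp: density_pair_def)
  show "J s \<phi> \<le> J (s + 1) \<psi>"
    if "moment_assumption \<mu> f0 f1 s \<phi> \<and> moment_assumption \<mu> f0 f1 (s + 1) \<psi> \<and> V s \<phi> \<subseteq> V (s + 1) \<psi>"
    for s \<phi> \<psi>
    using that by (intro J_mono) auto
  show "let m = m; V = dict_span m s \<phi>; h = h; N = (L2_norm m (L2_proj m V h))\<^sup>2; J = J s \<phi>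
    in N < 1 \<and> J = 2 * N / (1 - N) \<and> ereal J \<le> ceiling_J \<mu> f0 f1 \<and>
       (ereal J = ceiling_J \<mu> f0 f1 \<longleftrightarrow> h \<in> V)"
    if "moment_assumption \<mu> f0 f1 s \<phi>" for s \<phi>
    unfolding Let_def norm_L2_proj[OF that]
    by (intro conjI N_props[OF that] J_le_ceiling[OF that])
  show "moment_assumption \<mu> f0 f1 1 (\<lambda>_. h)" "ereal (J 1 (\<lambda>_. h)) = ceiling_J \<mu> f0 f1"
    if "vanishes_with \<mu> f0 f1 \<and> \<not> (AE x in \<mu>. f0 x = f1 x)"
    using h_feature that by auto
  show "AE x in \<mu>. h x = 0" "\<not> moment_assumption \<mu> f0 f1 1 (\<lambda>_. h)" "ceiling_J \<mu> f0 f1 = 0"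
    if "AE x in \<mu>. f0 x = f1 x"
    by (rule equal_densities[OF that])+
  show "ereal (J s \<phi>) = ceiling_J \<mu> f0 f1"
    if "AE x in \<mu>. f0 x = f1 x" "moment_assumption \<mu> f0 f1 s \<phi>" for s \<phi>
    by (rule equal_densities(4)[OF that])
  show "let m = m; \<Delta> = \<Delta>; V = (\<lambda>s. dict_span m s (\<Phi> s)) in
       \<Delta> < 2 \<and>
       (\<forall>s\<ge>1. moment_assumption \<mu> f0 f1 s (\<Phi> s) \<and> V s \<subseteq> V (s + 1)) \<and>
       (\<forall>g\<in>L2 m. \<forall>\<epsilon>>0. \<exists>h\<in>(\<Union>s\<in>{1..}. V s). L2_norm m (\<lambda>x. g x - h x) < \<epsilon>) \<longrightarrow>
         (\<forall>s\<ge>1. J s (\<Phi> s) \<le> J (s + 1) (\<Phi> (s + 1))) \<and>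
         (\<lambda>s. J s (\<Phi> s)) \<longlonglongrightarrow> 2 * \<Delta> / (2 - \<Delta>) \<and>
         L2_tendsto m (\<lambda>s. \<Lambda> s (\<Phi> s)) (\<lambda>x. 2 * h x / (2 - \<Delta>))" for \<Phi>
    unfolding Let_def
  proof (intro impI, elim conjE)
    assume *: "\<forall>s\<ge>1. moment_assumption \<mu> f0 f1 s (\<Phi> s) \<and> V s (\<Phi> s) \<subseteq> V (s + 1) (\<Phi> (s + 1))"
      and dense: "\<forall>g\<in>L2 m. \<forall>\<epsilon>>0. \<exists>h\<in>(\<Union>s\<in>{1..}. V s (\<Phi> s)). L2_norm m (\<lambda>x. g x - h x) < \<epsilon>"
    have mom: "moment_assumption \<mu> f0 f1 s (\<Phi> s)" if "1 \<le> s" for s using * that by blast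
    have nested: "V s (\<Phi> s) \<subseteq> V (s + 1) (\<Phi> (s + 1))" if "1 \<le> s" for s using * that by blast
    have "J s (\<Phi> s) \<le> J (s + 1) (\<Phi> (s + 1))" if "1 \<le> s" for s
      using that by (intro J_mono mom nested) auto
    with dense_limit[OF mom nested] dense
    show "(\<forall>s\<ge>1. J s (\<Phi> s) \<le> J (s + 1) (\<Phi> (s + 1))) \<and>
         (\<lambda>s. J s (\<Phi> s)) \<longlonglongrightarrow> 2 * \<Delta> / (2 - \<Delta>) \<and>
         L2_tendsto m (\<lambda>s. \<Lambda> s (\<Phi> s)) (\<lambda>x. 2 * h x / (2 - \<Delta>))"
      by blast
  qed
next
  let ?\<mu> = "count_space {0, 1 :: real}"
  \<comment> \<open>Reflection at p = 0.01: the ceiling, about 48.5, exceeds the divergence and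
    refutes the first inequality.\<close>
  have far: "ceiling_J ?\<mu> (bernoulli_density 0.01) (bernoulli_density 0.99) = ereal (0.98\<^sup>2 / 0.0198)"
    "sym_div ?\<mu> (bernoulli_density 0.01) (bernoulli_density 0.99) = ereal (1.96 * ln 99)"
    "density_pair ?\<mu> (bernoulli_density 0.01) (bernoulli_density 0.99)"
    "vanishes_with ?\<mu> (bernoulli_density 0.01) (bernoulli_density 0.99)"
    using bernoulli_reflection[of "0.01"] by (simp_all add: power2_eq_square)
  \<comment> \<open>Reflection at p = 0.2: the divergence exceeds the ceiling 1.125 and refutes the
    reverse inequality.\<close>
  have near: "ceiling_J ?\<mu> (bernoulli_density 0.2) (bernoulli_density 0.8) = ereal (0.36 / 0.32)"
    "sym_div ?\<mu> (bernoulli_density 0.2) (bernoulli_density 0.8) = ereal (1.2 * ln 4)"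
    "density_pair ?\<mu> (bernoulli_density 0.2) (bernoulli_density 0.8)"
    "vanishes_with ?\<mu> (bernoulli_density 0.2) (bernoulli_density 0.8)"
    using bernoulli_reflection[of "0.2"] by (simp_all add: power2_eq_square)
  show "\<not> (\<forall>\<mu> f0 f1. density_pair \<mu> f0 f1 \<and> vanishes_with \<mu> f0 f1 \<longrightarrow>
      ceiling_J \<mu> f0 f1 \<le> sym_div \<mu> f0 f1)"
  proof
    assume "\<forall>\<mu> f0 f1. density_pair \<mu> f0 f1 \<and> vanishes_with \<mu> f0 f1 \<longrightarrow>
      ceiling_J \<mu> f0 f1 \<le> sym_div \<mu> f0 f1"
    with far have "ereal (0.98\<^sup>2 / 0.0198) \<le> ereal (1.96 * ln 99)" by metis
    then show False using ln_bounds(2) by (simp add: power2_eq_square)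
  qed
  show "\<not> (\<forall>\<mu> f0 f1. density_pair \<mu> f0 f1 \<and> vanishes_with \<mu> f0 f1 \<longrightarrow>
      sym_div \<mu> f0 f1 \<le> ceiling_J \<mu> f0 f1)"
  proof
    assume "\<forall>\<mu> f0 f1. density_pair \<mu> f0 f1 \<and> vanishes_with \<mu> f0 f1 \<longrightarrow>
      sym_div \<mu> f0 f1 \<le> ceiling_J \<mu> f0 f1"
    with near have "ereal (1.2 * ln 4) \<le> ereal (0.36 / 0.32)" by metis
    then show False using ln_bounds(1) by simp
  qed
  show "let \<mu> = ?\<mu>; f0 = bernoulli_density 0.01; f1 = bernoulli_density 0.99 in
       ceiling_J \<mu> f0 f1 = ereal (0.98\<^sup>2 / 0.0198) \<and> \<bar>0.98\<^sup>2 / 0.0198 - 48.5 :: real\<bar> < 0.05 \<and>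
       sym_div \<mu> f0 f1 = ereal (1.96 * ln 99) \<and> \<bar>1.96 * ln 99 - 9.01 :: real\<bar> < 0.005"
    unfolding Let_def far(1,2) using ln_bounds(2) by (simp add: power2_eq_square abs_if)
  show "let \<mu> = ?\<mu>; f0 = bernoulli_density 0.2; f1 = bernoulli_density 0.8 in
       ceiling_J \<mu> f0 f1 = ereal (0.36 / 0.32) \<and> (0.36 / 0.32 :: real) = 1.125 \<and>
       sym_div \<mu> f0 f1 = ereal (1.2 * ln 4) \<and> \<bar>1.2 * ln 4 - 1.664 :: real\<bar> < 0.0005"
    unfolding Let_def near(1,2) using ln_bounds(1) by (simp add: abs_if)
qed

end
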